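(* Let $(V,E,F)$ be a simplicial $2$-complex with associated small strict $2$-category $\mathcal{C}^{V,E,F}$, let $(G,H,t,\alpha)$ be a Lie crossed module with associated strict $2$-groupoid $\mathcal{G}^{G,H}$, let $\mathcal{F},\tilde{\mathcal{F}}\colon\mathcal{C}^{V,E,F}\to\mathcal{G}^{G,H}$ be strict $2$-functors, and let $S$ be a $2$-action for $(G,H,t,\alpha)$. If there exists a pseudo-natural transformation $\eta\colon\mathcal{F}\Rightarrow\tilde{\mathcal{F}}$, then for every tetrahedron $(1,2,3,4)$ in $(V,E,F)$, $$S(\Phi_{1234})=S(\tilde\Phi_{1234}),$$ where $\Phi_{1234}$ and $\tilde\Phi_{1234}$ denote the $2$-holonomies of the tetrahedron computed using $\mathcal{F}$ and $\tilde{\mathcal{F}}$, respectively.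
   Context: **Convention.** All compositions are read from left to right: for $f\colon x\to y$ and $f'\colon y\to z$ the composite is $f\circ f'\colon x\to z$ (similarly for $\cdot$). **Lie crossed module.** $(G,H,t,\alpha)$ consists of Lie groups $G,H$ and Lie group homomorphisms $t\colon H\to G$ and $\alpha\colon G\to\mathrm{Aut}(H)$, written $\alpha(g)[h]$, such that $t(\alpha(g)[h])=g\,t(h)\,g^{-1}$ and $\alpha(t(h))[h']=hh'h^{-1}$ for all $g\in G$, $h,h'\in H$. The semidirect product $H\rtimes G$ has multiplication $(h_1,g_1)\cdot(h_2,g_2)=(h_1\,\alpha(g_1)[h_2],\,g_1g_2)$. **Small strict $2$-category.** Sets $\mathcal{C}_0$ (objects), $\mathcal{C}_1$ (morphisms), $\mathcal{C}_2$ ($2$-morphisms) such that: $(\mathcal{C}_0,\mathcal{C}_1,s^{(1)},t^{(1)},\mathrm{id}^{(1)},\cdot)$ is a small category; $(\mathcal{C}_1,\mathcal{C}_2,s^{(2)},t^{(2)},\mathrm{id}^{(2)},\circ)$ is a small category ($\circ$ is vertical composition); $s^{(1)}s^{(2)}=s^{(1)}t^{(2)}$ and $t^{(1)}s^{(2)}=t^{(1)}t^{(2)}$; and there is an associative horizontal composition $f_1\cdot f_2$ of $2$-morphisms, defined when $t^{(1)}(s^{(2)}(f_1))=s^{(1)}(s^{(2)}(f_2))$, for which $s^{(2)}(f_1\cdot f_2)=s^{(2)}(f_1)\cdot s^{(2)}(f_2)$, $t^{(2)}(f_1\cdot f_2)=t^{(2)}(f_1)\cdot t^{(2)}(f_2)$,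 the $2$-morphisms $\mathrm{id}^{(2)}(\mathrm{id}^{(1)}(x))$ are units, $\mathrm{id}^{(2)}_{g_1}\cdot\mathrm{id}^{(2)}_{g_2}=\mathrm{id}^{(2)}_{g_1\cdot g_2}$, and the exchange law $(f_1\circ f_1')\cdot(f_2\circ f_2')=(f_1\cdot f_2)\circ(f_1'\cdot f_2')$ holds whenever composable. One writes $f\colon g\Rightarrow g'$ if $s^{(2)}(f)=g$, $t^{(2)}(f)=g'$. A $2$-isomorphism is a $2$-morphism $f$ with a two-sided inverse $f^\ast$ with respect to $\circ$. **The $2$-groupoid $\mathcal{G}^{G,H}$.** One object $\ast$; morphisms are the elements of $G$, composed by multiplication; $2$-morphisms are the elements of $H\rtimes G$, with $s^{(2)}(h,g)=g$, $t^{(2)}(h,g)=t(h)g$, $\mathrm{id}^{(2)}_g=(1,g)$. Vertical composition is $(h,g)\circ(h',g')=(h'h,g)$, defined if and only if $g'=t(h)g$; vertical inverse is $(h,g)^\ast=(h^{-1},t(h)g)$. Horizontal composition $\cdot$ is the product of $H\rtimes G$. **Simplicial $2$-complex.** $(V,E,F)$ consists of sets $V$ (vertices), $E$ (edges), $F$ (faces) and maps $s,t\colon E\to V$ and $\partial_1,\partial_2,\partial_3\colon F\to E$ such that for all $f\in F$: $s(\partial_1f)=t(\partial_3f)$, $s(\partial_2f)=t(\partial_1f)$, $s(\partial_3f)=t(\partial_2f)$. Each edge $e\in E$ has an orientation-reversed counterpart $e^\ast\in E$ with $s(e^\ast)=t(e)$, $t(e^\ast)=s(e)$. **The $2$-category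 $\mathcal{C}^{V,E,F}$.** Objects: $V$. Morphisms: the edges $e$, their reversals $e^\ast$, identities $\mathrm{id}^{(1)}_v$ for $v\in V$, and all formal compositions of these, subject to $e\cdot e^\ast=\mathrm{id}^{(1)}_{s(e)}$, $e^\ast\cdot e=\mathrm{id}^{(1)}_{t(e)}$ and the unit laws. $2$-morphisms: - each face $f\in F$, with $s^{(2)}(f)=\partial_1f\cdot\partial_2f$ and $t^{(2)}(f)=(\partial_3f)^\ast$; - for each $f\in F$ a face $f^\ast$ with source $(\partial_3f)^\ast$ and target $\partial_1f\cdot\partial_2f$; - for each $f\in F$ a face $\overline f$ with source $(\partial_2f)^\ast\cdot(\partial_1f)^\ast$ and target $\partial_3f$; - identities $\mathrm{id}^{(2)}_e$; - all formal horizontal and vertical compositions of these, subject to the relations: $f\circ f^\ast=\mathrm{id}^{(2)}_{s^{(2)}(f)}$, $f^\ast\circ f=\mathrm{id}^{(2)}_{t^{(2)}(f)}$; $f\cdot\overline f=\mathrm{id}^{(2)}(\mathrm{id}^{(1)}(s^{(1)}(s^{(2)}(f))))$, $\overline f\cdot f=\mathrm{id}^{(2)}(\mathrm{id}^{(1)}(t^{(1)}(s^{(2)}(f))))$; the vertical and horizontal unit laws; $\mathrm{id}^{(2)}_{e_1\cdot e_2}=\mathrm{id}^{(2)}_{e_1}\cdot\mathrm{id}^{(2)}_{e_2}$; and the exchange law (together with the axioms of a strict $2$-category). **Strict $2$-functor.** A triple of maps on objects, morphisms and $2$-morphisms preserving all sources, targets, identities, composition of morphisms, and both vertical and horizontal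 composition of $2$-morphisms exactly. **Pseudo-natural transformation.** For strict $2$-functors $\mathcal{F},\tilde{\mathcal{F}}\colon\mathcal{C}\to\mathcal{C}'$, a pseudo-natural transformation $\eta\colon\mathcal{F}\Rightarrow\tilde{\mathcal{F}}$ assigns to each object $x$ of $\mathcal{C}$ a morphism $\eta_x\colon\mathcal{F}x\to\tilde{\mathcal{F}}x$ in $\mathcal{C}'$ and to each morphism $g\colon x\to y$ of $\mathcal{C}$ a $2$-isomorphism $\eta_g\colon\mathcal{F}g\cdot\eta_y\Rightarrow\eta_x\cdot\tilde{\mathcal{F}}g$ in $\mathcal{C}'$, such that: 1. for every $2$-morphism $f\colon g\Rightarrow g'$ with $g,g'\colon x\to y$, $(\mathcal{F}f\cdot\mathrm{id}^{(2)}_{\eta_y})\circ\eta_{g'}=\eta_g\circ(\mathrm{id}^{(2)}_{\eta_x}\cdot\tilde{\mathcal{F}}f)$; 2. for composable morphisms $g_1,g_2$, $\eta_{g_1\cdot g_2}=(\mathrm{id}^{(2)}_{\mathcal{F}g_1}\cdot\eta_{g_2})\circ(\eta_{g_1}\cdot\mathrm{id}^{(2)}_{\tilde{\mathcal{F}}g_2})$; 3. $\eta_{\mathrm{id}^{(1)}_x}=\mathrm{id}^{(2)}_{\eta_x}$ for every object $x$. **Tetrahedron.** A tetrahedron $(1,2,3,4)$ in $(V,E,F)$ is a collection of four vertices $1,2,3,4$, edges $e_{ij}\colon i\to j$ for $1\le i<j\le 4$, and four faces $\varphi_{ijk}\in F$ for $i<j<k$ whose edges match, i.e. $\partial_1\varphi_{ijk}=e_{ij}$,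 $\partial_2\varphi_{ijk}=e_{jk}$, $(\partial_3\varphi_{ijk})^\ast=e_{ik}$. **$2$-holonomy.** Given a strict $2$-functor $\mathcal{F}\colon\mathcal{C}^{V,E,F}\to\mathcal{G}^{G,H}$ and a tetrahedron $(1,2,3,4)$, put $g_{ij}:=\mathcal{F}(e_{ij})\in G$ and $f_{ijk}:=\mathcal{F}(\varphi_{ijk})\in H\rtimes G$, so that $f_{ijk}\colon g_{ij}g_{jk}\Rightarrow g_{ik}$. The $2$-holonomy is the $2$-morphism $\Phi_{1234}\colon g_{14}\Rightarrow g_{14}$ of $\mathcal{G}^{G,H}$, $$\Phi_{1234}:=f_{124}^\ast\circ(\mathrm{id}^{(2)}_{g_{12}}\cdot f_{234}^\ast)\circ(f_{123}\cdot\mathrm{id}^{(2)}_{g_{34}})\circ f_{134}.$$ Since its source and target agree, $\Phi_{1234}=(h_{1234},g_{14})$ with $h_{1234}\in\ker t$. **$2$-action.** A $2$-action $S$ is a real-valued function of the form $S(h,g)=s_0(h)$, defined on those $(h,g)\in H\rtimes G$ with $h\in\ker t$, where $s_0\colon\ker t\to\mathbb{R}$ satisfies $s_0(h'hh'^{-1})=s_0(h)$ for all $h\in\ker t$, $h'\in H$, and $s_0(\alpha(g)[h])=s_0(h)$ for all $h\in\ker t$, $g\in G$. *)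

theory Defs
  imports "HOL-Analysis.Analysis" "HOL-Algebra.Coset" "HOL-Algebra.Bij"
begin

section \<open>Smooth manifolds and Lie groups\<close>

text \<open>
  Points of \<open>\<real>\<^sup>n\<close> are the points of \<^const>\<open>Euclidean_space\<close> \<open>n\<close>, that is, sequences vanishing
  from index \<open>n\<close> on. This allows every dimension, including \<open>n = 0\<close> (discrete groups).
  On an open set, a function is of class \<open>C\<^sup>k\<^sup>+\<^sup>1\<close> iff its first partial derivatives exist and are of
  class \<open>C\<^sup>k\<close>.
\<close>

primrec C_k :: "nat \<Rightarrow> nat \<Rightarrow> (nat \<Rightarrow> real) set \<Rightarrow> ((nat \<Rightarrow> real) \<Rightarrow> real) \<Rightarrow> bool" where
  "C_k n 0 U f \<longleftrightarrow> continuous_map (subtopology (Euclidean_space n) U) euclideanreal f"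
| "C_k n (Suc k) U f \<longleftrightarrow>
     continuous_map (subtopology (Euclidean_space n) U) euclideanreal f \<and>
     (\<forall>i<n. \<exists>D. (\<forall>x\<in>U. ((\<lambda>s. f (x(i := s))) has_real_derivative D x) (at (x i))) \<and> C_k n k U D)"

definition smooth_Euclidean ::
    "nat \<Rightarrow> nat \<Rightarrow> (nat \<Rightarrow> real) set \<Rightarrow> ((nat \<Rightarrow> real) \<Rightarrow> nat \<Rightarrow> real) \<Rightarrow> bool" where
  "smooth_Euclidean m n U f \<longleftrightarrow> (\<forall>j<n. \<forall>k. C_k m k U (\<lambda>x. f x j))"

text \<open>The atlas need not be maximal; a chart is a pair of a domain and a coordinate map.\<close>

record 'a manifold =
  mtop :: "'a topology"
  mdim :: nat
  atlas :: "('a set \<times> ('a \<Rightarrow> nat \<Rightarrow> real)) set"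

locale smooth_manifold =
  fixes M :: "'a manifold"
  assumes Hausdorff: "Hausdorff_space (mtop M)"
    and second_countable: "second_countable (mtop M)"
    and covering: "topspace (mtop M) = (\<Union>(U, \<phi>)\<in>atlas M. U)"
    and chart_domain: "(U, \<phi>) \<in> atlas M \<Longrightarrow> openin (mtop M) U"
    and chart_image: "(U, \<phi>) \<in> atlas M \<Longrightarrow> openin (Euclidean_space (mdim M)) (\<phi> ` U)"
    and chart_homeo: "(U, \<phi>) \<in> atlas M \<Longrightarrow>
      homeomorphic_map (subtopology (mtop M) U)
        (subtopology (Euclidean_space (mdim M)) (\<phi> ` U)) \<phi>"
    and compatible: "(U, \<phi>) \<in> atlas M \<Longrightarrow> (W, \<psi>) \<in> atlas M \<Longrightarrow>
      smooth_Euclidean (mdim M) (mdim M) (\<phi> ` (U \<inter> W)) (\<psi> \<circ> inv_into U \<phi>)"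

definition smooth_map :: "'a manifold \<Rightarrow> 'b manifold \<Rightarrow> ('a \<Rightarrow> 'b) \<Rightarrow> bool" where
  "smooth_map M N f \<longleftrightarrow>
     continuous_map (mtop M) (mtop N) f \<and>
     (\<forall>(U, \<phi>)\<in>atlas M. \<forall>(W, \<psi>)\<in>atlas N.
        smooth_Euclidean (mdim M) (mdim N) (\<phi> ` {x \<in> U. f x \<in> W}) (\<psi> \<circ> f \<circ> inv_into U \<phi>))"

definition prod_chart ::
    "nat \<Rightarrow> ('a \<Rightarrow> nat \<Rightarrow> real) \<Rightarrow> ('b \<Rightarrow> nat \<Rightarrow> real) \<Rightarrow> 'a \<times> 'b \<Rightarrow> nat \<Rightarrow> real" where
  "prod_chart m \<phi> \<psi> = (\<lambda>(x, y) i. if i < m then \<phi> x i else \<psi> y (i - m))"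

definition prod_manifold :: "'a manifold \<Rightarrow> 'b manifold \<Rightarrow> ('a \<times> 'b) manifold" where
  "prod_manifold M N =
     \<lparr>mtop = prod_topology (mtop M) (mtop N),
      mdim = mdim M + mdim N,
      atlas = {(U \<times> W, prod_chart (mdim M) \<phi> \<psi>) |U \<phi> W \<psi>. (U, \<phi>) \<in> atlas M \<and> (W, \<psi>) \<in> atlas N}\<rparr>"

record 'a lie_group_struct = "'a monoid" +
  mfd :: "'a manifold"

locale lie_group = group G + mfd: smooth_manifold "mfd G"
  for G :: "'a lie_group_struct" (structure) +
  assumes carrier_mfd: "topspace (mtop (mfd G)) = carrier G"
    and smooth_mult: "smooth_map (prod_manifold (mfd G) (mfd G)) (mfd G) (\<lambda>(x, y). x \<otimes> y)"
    and smooth_inv: "smooth_map (mfd G) (mfd G) (\<lambda>x. inv x)"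

section \<open>Lie crossed modules\<close>

text \<open>
  \<^const>\<open>AutoGroup\<close> \<open>H\<close> consists of the automorphisms of \<open>H\<close>, extended by \<^const>\<open>undefined\<close> outside
  the carrier, with \<open>(a \<otimes> b) h = a (b h)\<close>; thus \<open>\<alpha>\<close> is a left action, as the multiplication of
  \<open>H \<rtimes> G\<close> requires. Smoothness of \<open>\<alpha> : G \<rightarrow> Aut(H)\<close> means smoothness of the action map
  \<open>G \<times> H \<rightarrow> H\<close>.
\<close>

locale lie_crossed_module = G: lie_group G + H: lie_group H
  for G :: "'g lie_group_struct" and H :: "'h lie_group_struct" +
  fixes t :: "'h \<Rightarrow> 'g" and \<alpha> :: "'g \<Rightarrow> 'h \<Rightarrow> 'h"
  assumes t_hom: "t \<in> hom H G"
    and t_smooth: "smooth_map (mfd H) (mfd G) t"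
    and \<alpha>_hom: "\<alpha> \<in> hom G (AutoGroup H)"
    and \<alpha>_smooth: "smooth_map (prod_manifold (mfd G) (mfd H)) (mfd H) (\<lambda>(g, h). \<alpha> g h)"
    and t_equivariant: "g \<in> carrier G \<Longrightarrow> h \<in> carrier H \<Longrightarrow>
      t (\<alpha> g h) = g \<otimes>\<^bsub>G\<^esub> t h \<otimes>\<^bsub>G\<^esub> inv\<^bsub>G\<^esub> g"
    and peiffer: "h \<in> carrier H \<Longrightarrow> h' \<in> carrier H \<Longrightarrow>
      \<alpha> (t h) h' = h \<otimes>\<^bsub>H\<^esub> h' \<otimes>\<^bsub>H\<^esub> inv\<^bsub>H\<^esub> h"

definition semidirect_product ::
    "('h, 'm) monoid_scheme \<Rightarrow> ('g, 'n) monoid_scheme \<Rightarrow> ('g \<Rightarrow> 'h \<Rightarrow> 'h) \<Rightarrow> ('h \<times> 'g) monoid" where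
  "semidirect_product H G \<alpha> =
     \<lparr>carrier = carrier H \<times> carrier G,
      mult = (\<lambda>(h1, g1) (h2, g2). (h1 \<otimes>\<^bsub>H\<^esub> \<alpha> g1 h2, g1 \<otimes>\<^bsub>G\<^esub> g2)),
      one = (\<one>\<^bsub>H\<^esub>, \<one>\<^bsub>G\<^esub>)\<rparr>"

section \<open>Small strict 2-categories\<close>

text \<open>All compositions are written in diagrammatic order.\<close>

record ('o, 'm, 'c) two_cat =
  Obj :: "'o set"
  Mor :: "'m set"
  Cell :: "'c set"
  src1 :: "'m \<Rightarrow> 'o"
  tgt1 :: "'m \<Rightarrow> 'o"
  id1 :: "'o \<Rightarrow> 'm"
  comp1 :: "'m \<Rightarrow> 'm \<Rightarrow> 'm" (infixl "\<cdot>\<index>" 70)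
  src2 :: "'c \<Rightarrow> 'm"
  tgt2 :: "'c \<Rightarrow> 'm"
  id2 :: "'m \<Rightarrow> 'c"
  vcomp :: "'c \<Rightarrow> 'c \<Rightarrow> 'c" (infixl "\<diamondop>\<index>" 65)
  hcomp :: "'c \<Rightarrow> 'c \<Rightarrow> 'c" (infixl "\<star>\<index>" 70)

locale small_category =
  fixes Ob :: "'o set" and Ar :: "'a set"
    and s :: "'a \<Rightarrow> 'o" and t :: "'a \<Rightarrow> 'o" and i :: "'o \<Rightarrow> 'a" and c :: "'a \<Rightarrow> 'a \<Rightarrow> 'a"
  assumes src_in: "f \<in> Ar \<Longrightarrow> s f \<in> Ob"
    and tgt_in: "f \<in> Ar \<Longrightarrow> t f \<in> Ob"
    and id_in: "x \<in> Ob \<Longrightarrow> i x \<in> Ar"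
    and src_id: "x \<in> Ob \<Longrightarrow> s (i x) = x"
    and tgt_id: "x \<in> Ob \<Longrightarrow> t (i x) = x"
    and comp_in: "f \<in> Ar \<Longrightarrow> g \<in> Ar \<Longrightarrow> t f = s g \<Longrightarrow> c f g \<in> Ar"
    and src_comp: "f \<in> Ar \<Longrightarrow> g \<in> Ar \<Longrightarrow> t f = s g \<Longrightarrow> s (c f g) = s f"
    and tgt_comp: "f \<in> Ar \<Longrightarrow> g \<in> Ar \<Longrightarrow> t f = s g \<Longrightarrow> t (c f g) = t g"
    and comp_assoc: "f \<in> Ar \<Longrightarrow> g \<in> Ar \<Longrightarrow> h \<in> Ar \<Longrightarrow> t f = s g \<Longrightarrow> t g = s h \<Longrightarrow>
      c (c f g) h = c f (c g h)"
    and id_comp: "f \<in> Ar \<Longrightarrow> c (i (s f)) f = f"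
    and comp_id: "f \<in> Ar \<Longrightarrow> c f (i (t f)) = f"

locale strict_2_category =
  cat1: small_category "Obj C" "Mor C" "src1 C" "tgt1 C" "id1 C" "comp1 C" +
  cat2: small_category "Mor C" "Cell C" "src2 C" "tgt2 C" "id2 C" "vcomp C"
  for C :: "('o, 'm, 'c) two_cat" (structure) +
  assumes src_globular: "f \<in> Cell C \<Longrightarrow> src1 C (src2 C f) = src1 C (tgt2 C f)"
    and tgt_globular: "f \<in> Cell C \<Longrightarrow> tgt1 C (src2 C f) = tgt1 C (tgt2 C f)"
    and hcomp_in: "f \<in> Cell C \<Longrightarrow> f' \<in> Cell C \<Longrightarrow> tgt1 C (src2 C f) = src1 C (src2 C f') \<Longrightarrow>
      f \<star> f' \<in> Cell C"
    and src_hcomp: "f \<in> Cell C \<Longrightarrow> f' \<in> Cell C \<Longrightarrow> tgt1 C (src2 C f) = src1 C (src2 C f') \<Longrightarrow>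
      src2 C (f \<star> f') = src2 C f \<cdot> src2 C f'"
    and tgt_hcomp: "f \<in> Cell C \<Longrightarrow> f' \<in> Cell C \<Longrightarrow> tgt1 C (src2 C f) = src1 C (src2 C f') \<Longrightarrow>
      tgt2 C (f \<star> f') = tgt2 C f \<cdot> tgt2 C f'"
    and hcomp_assoc: "f1 \<in> Cell C \<Longrightarrow> f2 \<in> Cell C \<Longrightarrow> f3 \<in> Cell C \<Longrightarrow>
      tgt1 C (src2 C f1) = src1 C (src2 C f2) \<Longrightarrow> tgt1 C (src2 C f2) = src1 C (src2 C f3) \<Longrightarrow>
      (f1 \<star> f2) \<star> f3 = f1 \<star> (f2 \<star> f3)"
    and id_hcomp: "f \<in> Cell C \<Longrightarrow> id2 C (id1 C (src1 C (src2 C f))) \<star> f = f"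
    and hcomp_id: "f \<in> Cell C \<Longrightarrow> f \<star> id2 C (id1 C (tgt1 C (src2 C f))) = f"
    and id2_hcomp: "g \<in> Mor C \<Longrightarrow> g' \<in> Mor C \<Longrightarrow> tgt1 C g = src1 C g' \<Longrightarrow>
      id2 C g \<star> id2 C g' = id2 C (g \<cdot> g')"
    and exchange: "f1 \<in> Cell C \<Longrightarrow> f1' \<in> Cell C \<Longrightarrow> f2 \<in> Cell C \<Longrightarrow> f2' \<in> Cell C \<Longrightarrow>
      tgt2 C f1 = src2 C f1' \<Longrightarrow> tgt2 C f2 = src2 C f2' \<Longrightarrow>
      tgt1 C (src2 C f1) = src1 C (src2 C f2) \<Longrightarrow>
      (f1 \<diamondop> f1') \<star> (f2 \<diamondop> f2') = (f1 \<star> f2) \<diamondop> (f1' \<star> f2')"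

definition two_iso :: "('o, 'm, 'c) two_cat \<Rightarrow> 'c \<Rightarrow> bool" where
  "two_iso C f \<longleftrightarrow> f \<in> Cell C \<and>
     (\<exists>f'\<in>Cell C. src2 C f' = tgt2 C f \<and> tgt2 C f' = src2 C f \<and>
        f \<diamondop>\<^bsub>C\<^esub> f' = id2 C (src2 C f) \<and> f' \<diamondop>\<^bsub>C\<^esub> f = id2 C (tgt2 C f))"

locale strict_2_functor = dom: strict_2_category C + cod: strict_2_category D
  for C :: "('o, 'm, 'c) two_cat" and D :: "('p, 'n, 'd) two_cat" +
  fixes F0 :: "'o \<Rightarrow> 'p" and F1 :: "'m \<Rightarrow> 'n" and F2 :: "'c \<Rightarrow> 'd"
  assumes F0_in: "x \<in> Obj C \<Longrightarrow> F0 x \<in> Obj D"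
    and F1_in: "g \<in> Mor C \<Longrightarrow> F1 g \<in> Mor D"
    and F2_in: "f \<in> Cell C \<Longrightarrow> F2 f \<in> Cell D"
    and F_src1: "g \<in> Mor C \<Longrightarrow> src1 D (F1 g) = F0 (src1 C g)"
    and F_tgt1: "g \<in> Mor C \<Longrightarrow> tgt1 D (F1 g) = F0 (tgt1 C g)"
    and F_id1: "x \<in> Obj C \<Longrightarrow> F1 (id1 C x) = id1 D (F0 x)"
    and F_comp1: "g \<in> Mor C \<Longrightarrow> g' \<in> Mor C \<Longrightarrow> tgt1 C g = src1 C g' \<Longrightarrow>
      F1 (g \<cdot>\<^bsub>C\<^esub> g') = F1 g \<cdot>\<^bsub>D\<^esub> F1 g'"
    and F_src2: "f \<in> Cell C \<Longrightarrow> src2 D (F2 f) = F1 (src2 C f)"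
    and F_tgt2: "f \<in> Cell C \<Longrightarrow> tgt2 D (F2 f) = F1 (tgt2 C f)"
    and F_id2: "g \<in> Mor C \<Longrightarrow> F2 (id2 C g) = id2 D (F1 g)"
    and F_vcomp: "f \<in> Cell C \<Longrightarrow> f' \<in> Cell C \<Longrightarrow> tgt2 C f = src2 C f' \<Longrightarrow>
      F2 (f \<diamondop>\<^bsub>C\<^esub> f') = F2 f \<diamondop>\<^bsub>D\<^esub> F2 f'"
    and F_hcomp: "f \<in> Cell C \<Longrightarrow> f' \<in> Cell C \<Longrightarrow> tgt1 C (src2 C f) = src1 C (src2 C f') \<Longrightarrow>
      F2 (f \<star>\<^bsub>C\<^esub> f') = F2 f \<star>\<^bsub>D\<^esub> F2 f'"

text \<open>\<open>\<eta>0\<close> and \<open>\<eta>1\<close> are the components at objects and at morphisms.\<close>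

locale pseudonatural_transformation =
  F: strict_2_functor C D F0 F1 F2 + F': strict_2_functor C D F0' F1' F2'
  for C :: "('o, 'm, 'c) two_cat" and D :: "('p, 'n, 'd) two_cat"
    and F0 F1 F2 F0' F1' F2' +
  fixes \<eta>0 :: "'o \<Rightarrow> 'n" and \<eta>1 :: "'m \<Rightarrow> 'd"
  assumes \<eta>0_in: "x \<in> Obj C \<Longrightarrow> \<eta>0 x \<in> Mor D"
    and \<eta>0_src: "x \<in> Obj C \<Longrightarrow> src1 D (\<eta>0 x) = F0 x"
    and \<eta>0_tgt: "x \<in> Obj C \<Longrightarrow> tgt1 D (\<eta>0 x) = F0' x"
    and \<eta>1_iso: "g \<in> Mor C \<Longrightarrow> two_iso D (\<eta>1 g)"
    and \<eta>1_src: "g \<in> Mor C \<Longrightarrow> src2 D (\<eta>1 g) = F1 g \<cdot>\<^bsub>D\<^esub> \<eta>0 (tgt1 C g)"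
    and \<eta>1_tgt: "g \<in> Mor C \<Longrightarrow> tgt2 D (\<eta>1 g) = \<eta>0 (src1 C g) \<cdot>\<^bsub>D\<^esub> F1' g"
    and \<eta>_cell: "f \<in> Cell C \<Longrightarrow>
      (F2 f \<star>\<^bsub>D\<^esub> id2 D (\<eta>0 (tgt1 C (src2 C f)))) \<diamondop>\<^bsub>D\<^esub> \<eta>1 (tgt2 C f) =
      \<eta>1 (src2 C f) \<diamondop>\<^bsub>D\<^esub> (id2 D (\<eta>0 (src1 C (src2 C f))) \<star>\<^bsub>D\<^esub> F2' f)"
    and \<eta>_comp: "g1 \<in> Mor C \<Longrightarrow> g2 \<in> Mor C \<Longrightarrow> tgt1 C g1 = src1 C g2 \<Longrightarrow>
      \<eta>1 (g1 \<cdot>\<^bsub>C\<^esub> g2) =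
      (id2 D (F1 g1) \<star>\<^bsub>D\<^esub> \<eta>1 g2) \<diamondop>\<^bsub>D\<^esub> (\<eta>1 g1 \<star>\<^bsub>D\<^esub> id2 D (F1' g2))"
    and \<eta>_id: "x \<in> Obj C \<Longrightarrow> \<eta>1 (id1 C x) = id2 D (\<eta>0 x)"

section \<open>The 2-groupoid of a crossed module\<close>

definition two_groupoid ::
    "('g, 'm) monoid_scheme \<Rightarrow> ('h, 'n) monoid_scheme \<Rightarrow> ('h \<Rightarrow> 'g) \<Rightarrow> ('g \<Rightarrow> 'h \<Rightarrow> 'h) \<Rightarrow>
      (unit, 'g, 'h \<times> 'g) two_cat" where
  "two_groupoid G H t \<alpha> =
     \<lparr>Obj = {()},
      Mor = carrier G,
      Cell = carrier (semidirect_product H G \<alpha>),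
      src1 = (\<lambda>_. ()),
      tgt1 = (\<lambda>_. ()),
      id1 = (\<lambda>_. \<one>\<^bsub>G\<^esub>),
      comp1 = mult G,
      src2 = (\<lambda>(h, g). g),
      tgt2 = (\<lambda>(h, g). t h \<otimes>\<^bsub>G\<^esub> g),
      id2 = (\<lambda>g. (\<one>\<^bsub>H\<^esub>, g)),
      vcomp = (\<lambda>(h, g) (h', g'). (h' \<otimes>\<^bsub>H\<^esub> h, g)),
      hcomp = mult (semidirect_product H G \<alpha>)\<rparr>"

definition vinv ::
    "('g, 'm) monoid_scheme \<Rightarrow> ('h, 'n) monoid_scheme \<Rightarrow> ('h \<Rightarrow> 'g) \<Rightarrow> 'h \<times> 'g \<Rightarrow> 'h \<times> 'g" where
  "vinv G H t = (\<lambda>(h, g). (inv\<^bsub>H\<^esub> h, t h \<otimes>\<^bsub>G\<^esub> g))"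

context lie_crossed_module
begin

lemma \<alpha>_auto: "g \<in> carrier G \<Longrightarrow> \<alpha> g \<in> hom H H \<inter> Bij (carrier H)"
  using \<alpha>_hom by (auto simp: hom_def AutoGroup_def auto_def Pi_def)

lemma \<alpha>_closed [simp]: "g \<in> carrier G \<Longrightarrow> h \<in> carrier H \<Longrightarrow> \<alpha> g h \<in> carrier H"
  using \<alpha>_auto[of g] by (auto simp: hom_def)

lemma \<alpha>_mult: "g \<in> carrier G \<Longrightarrow> h \<in> carrier H \<Longrightarrow> h' \<in> carrier H \<Longrightarrow>
    \<alpha> g (h \<otimes>\<^bsub>H\<^esub> h') = \<alpha> g h \<otimes>\<^bsub>H\<^esub> \<alpha> g h'"
  using \<alpha>_auto[of g] by (auto simp: hom_def)

lemma \<alpha>_one [simp]: "g \<in> carrier G \<Longrightarrow> \<alpha> g \<one>\<^bsub>H\<^esub> = \<one>\<^bsub>H\<^esub>"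
  using \<alpha>_auto[of g] by (intro hom_one[of _ H H]) auto

lemma \<alpha>_comp: "g \<in> carrier G \<Longrightarrow> g' \<in> carrier G \<Longrightarrow> h \<in> carrier H \<Longrightarrow>
    \<alpha> (g \<otimes>\<^bsub>G\<^esub> g') h = \<alpha> g (\<alpha> g' h)"
  using \<alpha>_hom \<alpha>_auto[of g] \<alpha>_auto[of g']
  by (simp add: hom_def AutoGroup_def BijGroup_def compose_def)

lemma one_\<alpha> [simp]:
  assumes "h \<in> carrier H" shows "\<alpha> \<one>\<^bsub>G\<^esub> h = h"
proof -
  have "inj_on (\<alpha> \<one>\<^bsub>G\<^esub>) (carrier H)"
    using \<alpha>_auto[of "\<one>\<^bsub>G\<^esub>"] by (auto simp: Bij_def bij_betw_def)
  moreover have "\<alpha> \<one>\<^bsub>G\<^esub> (\<alpha> \<one>\<^bsub>G\<^esub> h) = \<alpha> \<one>\<^bsub>G\<^esub> h"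
    using \<alpha>_comp[of "\<one>\<^bsub>G\<^esub>" "\<one>\<^bsub>G\<^esub>" h] assms by simp
  ultimately show ?thesis
    using assms by (meson G.one_closed \<alpha>_closed inj_onD)
qed

lemma t_closed [simp]: "h \<in> carrier H \<Longrightarrow> t h \<in> carrier G"
  using t_hom by (auto simp: hom_def)

lemma t_mult [simp]: "h \<in> carrier H \<Longrightarrow> h' \<in> carrier H \<Longrightarrow> t (h \<otimes>\<^bsub>H\<^esub> h') = t h \<otimes>\<^bsub>G\<^esub> t h'"
  using t_hom by (auto simp: hom_def)

lemma t_one [simp]: "t \<one>\<^bsub>H\<^esub> = \<one>\<^bsub>G\<^esub>"
  by (rule hom_one[OF t_hom]) (auto intro: H.group_axioms G.group_axioms)

lemma group_semidirect_product: "group (semidirect_product H G \<alpha>)"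
proof (rule groupI)
  fix x assume "x \<in> carrier (semidirect_product H G \<alpha>)"
  then obtain h g where "x = (h, g)" "h \<in> carrier H" "g \<in> carrier G"
    by (auto simp: semidirect_product_def)
  then show "\<exists>y\<in>carrier (semidirect_product H G \<alpha>).
      y \<otimes>\<^bsub>semidirect_product H G \<alpha>\<^esub> x = \<one>\<^bsub>semidirect_product H G \<alpha>\<^esub>"
    by (intro bexI[of _ "(inv\<^bsub>H\<^esub> (\<alpha> (inv\<^bsub>G\<^esub> g) h), inv\<^bsub>G\<^esub> g)"])
       (auto simp: semidirect_product_def)
qed (auto simp: semidirect_product_def \<alpha>_mult \<alpha>_comp G.m_assoc H.m_assoc)

lemma peiffer_mult: "h \<in> carrier H \<Longrightarrow> h' \<in> carrier H \<Longrightarrow>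
    \<alpha> (t h) h' \<otimes>\<^bsub>H\<^esub> h = h \<otimes>\<^bsub>H\<^esub> h'"
  by (simp add: peiffer H.m_assoc)

lemma t_\<alpha>_mult: "g \<in> carrier G \<Longrightarrow> h \<in> carrier H \<Longrightarrow> g' \<in> carrier G \<Longrightarrow>
    t (\<alpha> g h) \<otimes>\<^bsub>G\<^esub> (g \<otimes>\<^bsub>G\<^esub> g') = g \<otimes>\<^bsub>G\<^esub> (t h \<otimes>\<^bsub>G\<^esub> g')"
  by (simp add: t_equivariant G.m_assoc G.inv_solve_left')

theorem strict_2_category_two_groupoid: "strict_2_category (two_groupoid G H t \<alpha>)"
proof
  fix f1 f1' f2 f2'
  assume *: "f1 \<in> Cell (two_groupoid G H t \<alpha>)" "f1' \<in> Cell (two_groupoid G H t \<alpha>)"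
    "f2 \<in> Cell (two_groupoid G H t \<alpha>)" "f2' \<in> Cell (two_groupoid G H t \<alpha>)"
    "tgt2 (two_groupoid G H t \<alpha>) f1 = src2 (two_groupoid G H t \<alpha>) f1'"
    "tgt2 (two_groupoid G H t \<alpha>) f2 = src2 (two_groupoid G H t \<alpha>) f2'"
  obtain h1 g1 h1' g1' h2 g2 h2' g2'
    where f: "f1 = (h1, g1)" "f1' = (h1', g1')" "f2 = (h2, g2)" "f2' = (h2', g2')"
    by (cases f1; cases f1'; cases f2; cases f2')
  have c: "h1 \<in> carrier H" "h1' \<in> carrier H" "h2 \<in> carrier H" "h2' \<in> carrier H"
    "g1 \<in> carrier G" "g2 \<in> carrier G" and g1': "g1' = t h1 \<otimes>\<^bsub>G\<^esub> g1"
    using * by (auto simp: f two_groupoid_def semidirect_product_def)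
  have "h1' \<otimes>\<^bsub>H\<^esub> h1 \<otimes>\<^bsub>H\<^esub> (\<alpha> g1 h2' \<otimes>\<^bsub>H\<^esub> \<alpha> g1 h2) =
        h1' \<otimes>\<^bsub>H\<^esub> (\<alpha> (t h1) (\<alpha> g1 h2') \<otimes>\<^bsub>H\<^esub> h1) \<otimes>\<^bsub>H\<^esub> \<alpha> g1 h2"
    using c by (simp add: peiffer_mult H.m_assoc)
  then show "(f1 \<diamondop>\<^bsub>two_groupoid G H t \<alpha>\<^esub> f1') \<star>\<^bsub>two_groupoid G H t \<alpha>\<^esub>
      (f2 \<diamondop>\<^bsub>two_groupoid G H t \<alpha>\<^esub> f2') =
      (f1 \<star>\<^bsub>two_groupoid G H t \<alpha>\<^esub> f2) \<diamondop>\<^bsub>two_groupoid G H t \<alpha>\<^esub>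
      (f1' \<star>\<^bsub>two_groupoid G H t \<alpha>\<^esub> f2')"
    using c by (simp add: f g1' two_groupoid_def semidirect_product_def \<alpha>_mult \<alpha>_comp H.m_assoc)
qed (auto simp: two_groupoid_def semidirect_product_def \<alpha>_mult \<alpha>_comp G.m_assoc H.m_assoc t_\<alpha>_mult)

lemma vinv_inverse:
  assumes "f \<in> Cell (two_groupoid G H t \<alpha>)"
  shows "f \<diamondop>\<^bsub>two_groupoid G H t \<alpha>\<^esub> vinv G H t f =
      id2 (two_groupoid G H t \<alpha>) (src2 (two_groupoid G H t \<alpha>) f)"
    and "vinv G H t f \<diamondop>\<^bsub>two_groupoid G H t \<alpha>\<^esub> f =
      id2 (two_groupoid G H t \<alpha>) (tgt2 (two_groupoid G H t \<alpha>) f)"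
  using assms by (auto simp: two_groupoid_def semidirect_product_def vinv_def)

end

section \<open>Simplicial 2-complexes and the 2-categories they generate\<close>

record ('v, 'e, 'f) complex2 =
  verts :: "'v set"
  edges :: "'e set"
  faces :: "'f set"
  esrc :: "'e \<Rightarrow> 'v"
  etgt :: "'e \<Rightarrow> 'v"
  rev_edge :: "'e \<Rightarrow> 'e"
  bd1 :: "'f \<Rightarrow> 'e"
  bd2 :: "'f \<Rightarrow> 'e"
  bd3 :: "'f \<Rightarrow> 'e"

locale simplicial_2_complex =
  fixes K :: "('v, 'e, 'f) complex2"
  assumes esrc_in: "e \<in> edges K \<Longrightarrow> esrc K e \<in> verts K"
    and etgt_in: "e \<in> edges K \<Longrightarrow> etgt K e \<in> verts K"
    and rev_in: "e \<in> edges K \<Longrightarrow> rev_edge K e \<in> edges K"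
    and esrc_rev: "e \<in> edges K \<Longrightarrow> esrc K (rev_edge K e) = etgt K e"
    and etgt_rev: "e \<in> edges K \<Longrightarrow> etgt K (rev_edge K e) = esrc K e"
    and bd1_in: "f \<in> faces K \<Longrightarrow> bd1 K f \<in> edges K"
    and bd2_in: "f \<in> faces K \<Longrightarrow> bd2 K f \<in> edges K"
    and bd3_in: "f \<in> faces K \<Longrightarrow> bd3 K f \<in> edges K"
    and bd_13: "f \<in> faces K \<Longrightarrow> esrc K (bd1 K f) = etgt K (bd3 K f)"
    and bd_21: "f \<in> faces K \<Longrightarrow> esrc K (bd2 K f) = etgt K (bd1 K f)"
    and bd_32: "f \<in> faces K \<Longrightarrow> esrc K (bd3 K f) = etgt K (bd2 K f)"

subsection \<open>Morphisms: formal composites of edges modulo relations\<close>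

datatype ('v, 'e) path = Edge 'e | Ident 'v | Comp "('v, 'e) path" "('v, 'e) path"

primrec psrc :: "('v, 'e, 'f) complex2 \<Rightarrow> ('v, 'e) path \<Rightarrow> 'v" where
  "psrc K (Edge e) = esrc K e"
| "psrc K (Ident v) = v"
| "psrc K (Comp p q) = psrc K p"

primrec ptgt :: "('v, 'e, 'f) complex2 \<Rightarrow> ('v, 'e) path \<Rightarrow> 'v" where
  "ptgt K (Edge e) = etgt K e"
| "ptgt K (Ident v) = v"
| "ptgt K (Comp p q) = ptgt K q"

primrec pwf :: "('v, 'e, 'f) complex2 \<Rightarrow> ('v, 'e) path \<Rightarrow> bool" where
  "pwf K (Edge e) \<longleftrightarrow> e \<in> edges K"
| "pwf K (Ident v) \<longleftrightarrow> v \<in> verts K"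
| "pwf K (Comp p q) \<longleftrightarrow> pwf K p \<and> pwf K q \<and> ptgt K p = psrc K q"

inductive peq :: "('v, 'e, 'f) complex2 \<Rightarrow> ('v, 'e) path \<Rightarrow> ('v, 'e) path \<Rightarrow> bool"
  for K where
  peq_refl: "pwf K p \<Longrightarrow> peq K p p"
| peq_sym: "peq K p q \<Longrightarrow> peq K q p"
| peq_trans: "peq K p q \<Longrightarrow> peq K q r \<Longrightarrow> peq K p r"
| peq_cong: "peq K p p' \<Longrightarrow> peq K q q' \<Longrightarrow> ptgt K p = psrc K q \<Longrightarrow> peq K (Comp p q) (Comp p' q')"
| peq_assoc: "pwf K (Comp (Comp p q) r) \<Longrightarrow> peq K (Comp (Comp p q) r) (Comp p (Comp q r))"
| peq_unit_left: "pwf K p \<Longrightarrow> peq K (Comp (Ident (psrc K p)) p) p"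
| peq_unit_right: "pwf K p \<Longrightarrow> peq K (Comp p (Ident (ptgt K p))) p"
| peq_rev_right: "e \<in> edges K \<Longrightarrow> peq K (Comp (Edge e) (Edge (rev_edge K e))) (Ident (esrc K e))"
| peq_rev_left: "e \<in> edges K \<Longrightarrow> peq K (Comp (Edge (rev_edge K e)) (Edge e)) (Ident (etgt K e))"

subsection \<open>2-morphisms: formal composites of faces modulo relations\<close>

text \<open>\<open>FaceInv f\<close> and \<open>FaceBar f\<close> are the generators \<open>f\<^sup>*\<close> and \<open>f\<close> with a bar.\<close>

datatype ('v, 'e, 'f) surf =
    Face 'f
  | FaceInv 'f
  | FaceBar 'f
  | IdS "('v, 'e) path"
  | VComp "('v, 'e, 'f) surf" "('v, 'e, 'f) surf"
  | HComp "('v, 'e, 'f) surf" "('v, 'e, 'f) surf"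

primrec ssrc :: "('v, 'e, 'f) complex2 \<Rightarrow> ('v, 'e, 'f) surf \<Rightarrow> ('v, 'e) path" where
  "ssrc K (Face f) = Comp (Edge (bd1 K f)) (Edge (bd2 K f))"
| "ssrc K (FaceInv f) = Edge (rev_edge K (bd3 K f))"
| "ssrc K (FaceBar f) = Comp (Edge (rev_edge K (bd2 K f))) (Edge (rev_edge K (bd1 K f)))"
| "ssrc K (IdS p) = p"
| "ssrc K (VComp a b) = ssrc K a"
| "ssrc K (HComp a b) = Comp (ssrc K a) (ssrc K b)"

primrec stgt :: "('v, 'e, 'f) complex2 \<Rightarrow> ('v, 'e, 'f) surf \<Rightarrow> ('v, 'e) path" where
  "stgt K (Face f) = Edge (rev_edge K (bd3 K f))"
| "stgt K (FaceInv f) = Comp (Edge (bd1 K f)) (Edge (bd2 K f))"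
| "stgt K (FaceBar f) = Edge (bd3 K f)"
| "stgt K (IdS p) = p"
| "stgt K (VComp a b) = stgt K b"
| "stgt K (HComp a b) = Comp (stgt K a) (stgt K b)"

primrec swf :: "('v, 'e, 'f) complex2 \<Rightarrow> ('v, 'e, 'f) surf \<Rightarrow> bool" where
  "swf K (Face f) \<longleftrightarrow> f \<in> faces K"
| "swf K (FaceInv f) \<longleftrightarrow> f \<in> faces K"
| "swf K (FaceBar f) \<longleftrightarrow> f \<in> faces K"
| "swf K (IdS p) \<longleftrightarrow> pwf K p"
| "swf K (VComp a b) \<longleftrightarrow> swf K a \<and> swf K b \<and> peq K (stgt K a) (ssrc K b)"
| "swf K (HComp a b) \<longleftrightarrow> swf K a \<and> swf K b \<and> ptgt K (ssrc K a) = psrc K (ssrc K b)"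

inductive seq :: "('v, 'e, 'f) complex2 \<Rightarrow> ('v, 'e, 'f) surf \<Rightarrow> ('v, 'e, 'f) surf \<Rightarrow> bool"
  for K where
  seq_refl: "swf K a \<Longrightarrow> seq K a a"
| seq_sym: "seq K a b \<Longrightarrow> seq K b a"
| seq_trans: "seq K a b \<Longrightarrow> seq K b c \<Longrightarrow> seq K a c"
| seq_id_cong: "peq K p q \<Longrightarrow> seq K (IdS p) (IdS q)"
| seq_vcong: "seq K a a' \<Longrightarrow> seq K b b' \<Longrightarrow> swf K (VComp a b) \<Longrightarrow> seq K (VComp a b) (VComp a' b')"
| seq_hcong: "seq K a a' \<Longrightarrow> seq K b b' \<Longrightarrow> swf K (HComp a b) \<Longrightarrow> seq K (HComp a b) (HComp a' b')"
| seq_vassoc: "swf K (VComp (VComp a b) c) \<Longrightarrow>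
    seq K (VComp (VComp a b) c) (VComp a (VComp b c))"
| seq_hassoc: "swf K (HComp (HComp a b) c) \<Longrightarrow>
    seq K (HComp (HComp a b) c) (HComp a (HComp b c))"
| seq_vunit_left: "swf K a \<Longrightarrow> seq K (VComp (IdS (ssrc K a)) a) a"
| seq_vunit_right: "swf K a \<Longrightarrow> seq K (VComp a (IdS (stgt K a))) a"
| seq_hunit_left: "swf K a \<Longrightarrow> seq K (HComp (IdS (Ident (psrc K (ssrc K a)))) a) a"
| seq_hunit_right: "swf K a \<Longrightarrow> seq K (HComp a (IdS (Ident (ptgt K (ssrc K a))))) a"
| seq_id_comp: "pwf K (Comp p q) \<Longrightarrow> seq K (IdS (Comp p q)) (HComp (IdS p) (IdS q))"
| seq_exchange: "swf K (HComp (VComp a a') (VComp b b')) \<Longrightarrow>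
    seq K (HComp (VComp a a') (VComp b b')) (VComp (HComp a b) (HComp a' b'))"
| seq_inv_right: "f \<in> faces K \<Longrightarrow> seq K (VComp (Face f) (FaceInv f)) (IdS (ssrc K (Face f)))"
| seq_inv_left: "f \<in> faces K \<Longrightarrow> seq K (VComp (FaceInv f) (Face f)) (IdS (stgt K (Face f)))"
| seq_bar_right: "f \<in> faces K \<Longrightarrow>
    seq K (HComp (Face f) (FaceBar f)) (IdS (Ident (psrc K (ssrc K (Face f)))))"
| seq_bar_left: "f \<in> faces K \<Longrightarrow>
    seq K (HComp (FaceBar f) (Face f)) (IdS (Ident (ptgt K (ssrc K (Face f)))))"

subsection \<open>The quotient 2-category\<close>

definition path_rel :: "('v, 'e, 'f) complex2 \<Rightarrow> ('v, 'e) path rel" where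
  "path_rel K = {(p, q). peq K p q}"

definition surf_rel :: "('v, 'e, 'f) complex2 \<Rightarrow> ('v, 'e, 'f) surf rel" where
  "surf_rel K = {(a, b). seq K a b}"

definition path_class :: "('v, 'e, 'f) complex2 \<Rightarrow> ('v, 'e) path \<Rightarrow> ('v, 'e) path set" where
  "path_class K p = path_rel K `` {p}"

definition surf_class :: "('v, 'e, 'f) complex2 \<Rightarrow> ('v, 'e, 'f) surf \<Rightarrow> ('v, 'e, 'f) surf set" where
  "surf_class K a = surf_rel K `` {a}"

text \<open>
  Operations on classes are the saturations of the operations on representatives; the lemmas
  below show that they are computed on any choice of representatives.
\<close>

definition two_cat_of ::
    "('v, 'e, 'f) complex2 \<Rightarrow> ('v, ('v, 'e) path set, ('v, 'e, 'f) surf set) two_cat" where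
  "two_cat_of K =
     \<lparr>Obj = verts K,
      Mor = {p. pwf K p} // path_rel K,
      Cell = {a. swf K a} // surf_rel K,
      src1 = (\<lambda>P. the_elem (psrc K ` P)),
      tgt1 = (\<lambda>P. the_elem (ptgt K ` P)),
      id1 = (\<lambda>v. path_class K (Ident v)),
      comp1 = (\<lambda>P Q. path_rel K `` {Comp p q |p q. p \<in> P \<and> q \<in> Q}),
      src2 = (\<lambda>A. path_rel K `` (ssrc K ` A)),
      tgt2 = (\<lambda>A. path_rel K `` (stgt K ` A)),
      id2 = (\<lambda>P. surf_rel K `` (IdS ` P)),
      vcomp = (\<lambda>A B. surf_rel K `` {VComp a b |a b. a \<in> A \<and> b \<in> B}),
      hcomp = (\<lambda>A B. surf_rel K `` {HComp a b |a b. a \<in> A \<and> b \<in> B})\<rparr>"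

context simplicial_2_complex
begin

declare peq_trans [trans]

lemma psrc_in: "pwf K p \<Longrightarrow> psrc K p \<in> verts K"
  by (induction p) (auto intro: esrc_in)

lemma ptgt_in: "pwf K p \<Longrightarrow> ptgt K p \<in> verts K"
  by (induction p) (auto intro: etgt_in)

lemma peq_wf: "peq K p q \<Longrightarrow> pwf K p \<and> pwf K q \<and> psrc K p = psrc K q \<and> ptgt K p = ptgt K q"
  by (induction rule: peq.induct)
     (auto simp: rev_in esrc_rev etgt_rev esrc_in etgt_in psrc_in ptgt_in)

lemma swf_bd:
  "swf K a \<Longrightarrow> pwf K (ssrc K a) \<and> pwf K (stgt K a) \<and>
     psrc K (ssrc K a) = psrc K (stgt K a) \<and> ptgt K (ssrc K a) = ptgt K (stgt K a)"
  by (induction a)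
     (auto simp: rev_in esrc_rev etgt_rev bd1_in bd2_in bd3_in bd_13 bd_21 bd_32 dest: peq_wf)

lemma face_bar_right: assumes "f \<in> faces K"
  shows "peq K (Comp (Comp (Edge (bd1 K f)) (Edge (bd2 K f)))
      (Comp (Edge (rev_edge K (bd2 K f))) (Edge (rev_edge K (bd1 K f))))) (Ident (esrc K (bd1 K f)))"
    (is "peq K (Comp (Comp ?a ?b) (Comp ?b' ?a')) _")
proof -
  have wf: "pwf K ?a" "pwf K ?b" "pwf K ?a'" "pwf K ?b'" "ptgt K ?a = psrc K ?b"
    "ptgt K ?b = psrc K ?b'" "ptgt K ?b' = psrc K ?a'" "ptgt K ?b' = psrc K ?b"
    "ptgt K ?a = psrc K ?a'"
    using assms by (auto simp: rev_in esrc_rev etgt_rev bd1_in bd2_in bd_21)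
  have "peq K (Comp (Comp ?a ?b) (Comp ?b' ?a')) (Comp ?a (Comp ?b (Comp ?b' ?a')))"
    using wf by (intro peq_assoc) auto
  also have "peq K \<dots> (Comp ?a (Comp (Comp ?b ?b') ?a'))"
    using wf by (intro peq_cong peq_refl peq_sym[OF peq_assoc]) auto
  also have "peq K \<dots> (Comp ?a (Comp (Ident (psrc K ?a')) ?a'))"
    using wf peq_rev_right[of "bd2 K f" K] by (intro peq_cong peq_refl) auto
  also have "peq K \<dots> (Comp ?a ?a')"
    using wf by (intro peq_cong peq_refl peq_unit_left) auto
  also have "peq K \<dots> (Ident (esrc K (bd1 K f)))"
    using assms by (intro peq_rev_right bd1_in)
  finally show ?thesis .
qed

lemma face_bar_left: assumes "f \<in> faces K"
  shows "peq K (Comp (Comp (Edge (rev_edge K (bd2 K f))) (Edge (rev_edge K (bd1 K f))))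
      (Comp (Edge (bd1 K f)) (Edge (bd2 K f)))) (Ident (etgt K (bd2 K f)))"
    (is "peq K (Comp (Comp ?b' ?a') (Comp ?a ?b)) _")
proof -
  have wf: "pwf K ?a" "pwf K ?b" "pwf K ?a'" "pwf K ?b'" "ptgt K ?a = psrc K ?b"
    "ptgt K ?a' = psrc K ?a" "ptgt K ?b' = psrc K ?a'" "ptgt K ?b' = psrc K ?b"
    "ptgt K ?a' = psrc K ?a"
    using assms by (auto simp: rev_in esrc_rev etgt_rev bd1_in bd2_in bd_21)
  have "peq K (Comp (Comp ?b' ?a') (Comp ?a ?b)) (Comp ?b' (Comp ?a' (Comp ?a ?b)))"
    using wf by (intro peq_assoc) auto
  also have "peq K \<dots> (Comp ?b' (Comp (Comp ?a' ?a) ?b))"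
    using wf by (intro peq_cong peq_refl peq_sym[OF peq_assoc]) auto
  also have "peq K \<dots> (Comp ?b' (Comp (Ident (psrc K ?b)) ?b))"
    using wf peq_rev_left[of "bd1 K f" K] by (intro peq_cong peq_refl) auto
  also have "peq K \<dots> (Comp ?b' ?b)"
    using wf by (intro peq_cong peq_refl peq_unit_left) auto
  also have "peq K \<dots> (Ident (etgt K (bd2 K f)))"
    using assms by (intro peq_rev_left bd2_in)
  finally show ?thesis .
qed

lemma seq_wf:
  "seq K a b \<Longrightarrow> swf K a \<and> swf K b \<and> peq K (ssrc K a) (ssrc K b) \<and> peq K (stgt K a) (stgt K b)"
proof (induction rule: seq.induct)
  case (seq_refl a)
  then show ?case using swf_bd by (auto intro: peq_refl)
next
  case (seq_sym a b)
  then show ?case by (auto intro: peq_sym)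
next
  case (seq_trans a b c)
  then show ?case by (auto intro: peq_trans)
next
  case (seq_id_cong p q)
  then show ?case by (auto dest: peq_wf)
next
  case (seq_vcong a a' b b')
  then show ?case by (auto intro: peq_trans peq_sym)
next
  case (seq_hcong a a' b b')
  moreover have "ptgt K (stgt K a) = psrc K (stgt K b)"
    using seq_hcong.hyps swf_bd[of a] swf_bd[of b] by simp
  moreover have "ptgt K (ssrc K a') = psrc K (ssrc K b')"
    using seq_hcong peq_wf by (metis swf.simps(6))
  ultimately show ?case by (auto intro!: peq_cong)
next
  case (seq_vassoc a b c)
  then show ?case using swf_bd[of a] swf_bd[of c] by (auto intro: peq_refl)
next
  case (seq_hassoc a b c)
  then show ?case using swf_bd[of a] swf_bd[of b] swf_bd[of c]
    by (auto intro!: peq_assoc)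
next
  case (seq_vunit_left a)
  then show ?case using swf_bd[of a] by (auto intro: peq_refl)
next
  case (seq_vunit_right a)
  then show ?case using swf_bd[of a] by (auto intro: peq_refl)
next
  case (seq_hunit_left a)
  then show ?case using swf_bd[of a] peq_unit_left[of K "ssrc K a"] peq_unit_left[of K "stgt K a"]
    by (auto intro: psrc_in)
next
  case (seq_hunit_right a)
  then show ?case using swf_bd[of a] peq_unit_right[of K "ssrc K a"] peq_unit_right[of K "stgt K a"]
    by (auto intro: ptgt_in)
next
  case (seq_id_comp p q)
  then show ?case by (auto intro: peq_refl)
next
  case (seq_exchange a a' b b')
  then show ?case using swf_bd[of a] swf_bd[of a'] swf_bd[of b] swf_bd[of b']
      peq_wf[of "stgt K a" "ssrc K a'"] peq_wf[of "stgt K b" "ssrc K b'"]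
    by (auto intro!: peq_cong peq_refl)
next
  case (seq_inv_right f)
  then show ?case using swf_bd[of "Face f"] by (auto intro: peq_refl)
next
  case (seq_inv_left f)
  then show ?case using swf_bd[of "Face f"] by (auto intro: peq_refl)
next
  case (seq_bar_right f)
  have "peq K (Comp (Edge (rev_edge K (bd3 K f))) (Edge (bd3 K f))) (Ident (etgt K (bd3 K f)))"
    using seq_bar_right by (intro peq_rev_left bd3_in)
  then show ?case using seq_bar_right face_bar_right[of f]
    by (auto simp: rev_in esrc_rev etgt_rev bd1_in bd2_in bd3_in bd_13 bd_21 bd_32 esrc_in etgt_in)
next
  case (seq_bar_left f)
  have "peq K (Comp (Edge (bd3 K f)) (Edge (rev_edge K (bd3 K f)))) (Ident (esrc K (bd3 K f)))"
    using seq_bar_left by (intro peq_rev_right bd3_in)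
  then show ?case using seq_bar_left face_bar_left[of f]
    by (auto simp: rev_in esrc_rev etgt_rev bd1_in bd2_in bd3_in bd_13 bd_21 bd_32 esrc_in etgt_in)
qed

lemma path_class_eq: "peq K p q \<Longrightarrow> path_class K p = path_class K q"
  by (auto simp: path_class_def path_rel_def intro: peq_trans peq_sym)

lemma surf_class_eq: "seq K a b \<Longrightarrow> surf_class K a = surf_class K b"
  by (auto simp: surf_class_def surf_rel_def intro: seq_trans seq_sym)

lemma in_path_class [simp]: "q \<in> path_class K p \<longleftrightarrow> peq K p q"
  by (simp add: path_class_def path_rel_def)

lemma in_surf_class [simp]: "b \<in> surf_class K a \<longleftrightarrow> seq K a b"
  by (simp add: surf_class_def surf_rel_def)

lemma path_class_eq_iff: "pwf K p \<Longrightarrow> path_class K p = path_class K q \<longleftrightarrow> peq K p q"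
  by (metis in_path_class path_class_eq peq_refl peq_sym)

lemma Obj_two_cat_of [simp]: "Obj (two_cat_of K) = verts K"
  by (simp add: two_cat_of_def)

lemma Mor_two_cat_of: "Mor (two_cat_of K) = path_class K ` {p. pwf K p}"
  by (auto simp: two_cat_of_def quotient_def path_class_def)

lemma Cell_two_cat_of: "Cell (two_cat_of K) = surf_class K ` {a. swf K a}"
  by (auto simp: two_cat_of_def quotient_def surf_class_def)

lemma src1_class [simp]:
  assumes "pwf K p" shows "src1 (two_cat_of K) (path_class K p) = psrc K p"
proof -
  have "psrc K ` path_class K p = {psrc K p}"
    using peq_refl[OF assms] by (force dest: peq_wf)
  then show ?thesis by (simp add: two_cat_of_def)
qed

lemma tgt1_class [simp]:
  assumes "pwf K p" shows "tgt1 (two_cat_of K) (path_class K p) = ptgt K p"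
proof -
  have "ptgt K ` path_class K p = {ptgt K p}"
    using peq_refl[OF assms] by (force dest: peq_wf)
  then show ?thesis by (simp add: two_cat_of_def)
qed

lemma id1_class [simp]: "id1 (two_cat_of K) v = path_class K (Ident v)"
  by (simp add: two_cat_of_def)

lemma comp1_class [simp]:
  assumes "pwf K p" "pwf K q" "ptgt K p = psrc K q"
  shows "path_class K p \<cdot>\<^bsub>two_cat_of K\<^esub> path_class K q = path_class K (Comp p q)"
proof (intro Set.set_eqI iffI)
  fix r assume "r \<in> path_class K p \<cdot>\<^bsub>two_cat_of K\<^esub> path_class K q"
  then obtain p' q' where "peq K p p'" "peq K q q'" "peq K (Comp p' q') r"
    by (auto simp: two_cat_of_def path_rel_def)
  then show "r \<in> path_class K (Comp p q)"
    using assms by (auto intro: peq_trans peq_cong)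
next
  fix r assume "r \<in> path_class K (Comp p q)"
  then show "r \<in> path_class K p \<cdot>\<^bsub>two_cat_of K\<^esub> path_class K q"
    using peq_refl[OF assms(1)] peq_refl[OF assms(2)]
    by (simp add: two_cat_of_def path_rel_def Image_iff Bex_def) blast
qed

lemma src2_class [simp]:
  assumes "swf K a" shows "src2 (two_cat_of K) (surf_class K a) = path_class K (ssrc K a)"
proof (intro Set.set_eqI iffI)
  fix p assume "p \<in> src2 (two_cat_of K) (surf_class K a)"
  then obtain b where "seq K a b" "peq K (ssrc K b) p"
    by (auto simp: two_cat_of_def path_rel_def)
  then show "p \<in> path_class K (ssrc K a)"
    using seq_wf[of a b] peq_trans[of K "ssrc K a" "ssrc K b" p] by simp
next
  fix p assume "p \<in> path_class K (ssrc K a)"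
  then show "p \<in> src2 (two_cat_of K) (surf_class K a)"
    using seq_refl[OF assms] by (simp add: two_cat_of_def path_rel_def Image_iff Bex_def) blast
qed

lemma tgt2_class [simp]:
  assumes "swf K a" shows "tgt2 (two_cat_of K) (surf_class K a) = path_class K (stgt K a)"
proof (intro Set.set_eqI iffI)
  fix p assume "p \<in> tgt2 (two_cat_of K) (surf_class K a)"
  then obtain b where "seq K a b" "peq K (stgt K b) p"
    by (auto simp: two_cat_of_def path_rel_def)
  then show "p \<in> path_class K (stgt K a)"
    using seq_wf[of a b] peq_trans[of K "stgt K a" "stgt K b" p] by simp
next
  fix p assume "p \<in> path_class K (stgt K a)"
  then show "p \<in> tgt2 (two_cat_of K) (surf_class K a)"
    using seq_refl[OF assms] by (simp add: two_cat_of_def path_rel_def Image_iff Bex_def) blast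
qed

lemma id2_class [simp]:
  assumes "pwf K p" shows "id2 (two_cat_of K) (path_class K p) = surf_class K (IdS p)"
proof (intro Set.set_eqI iffI)
  fix a assume "a \<in> id2 (two_cat_of K) (path_class K p)"
  then obtain q where "peq K p q" "seq K (IdS q) a"
    by (auto simp: two_cat_of_def surf_rel_def)
  then show "a \<in> surf_class K (IdS p)"
    using seq_trans[OF seq_id_cong, of K p q a] by simp
next
  fix a assume "a \<in> surf_class K (IdS p)"
  then show "a \<in> id2 (two_cat_of K) (path_class K p)"
    using peq_refl[OF assms] by (simp add: two_cat_of_def surf_rel_def Image_iff Bex_def) blast
qed

lemma vcomp_class [simp]:
  assumes "swf K a" "swf K b" "peq K (stgt K a) (ssrc K b)"
  shows "surf_class K a \<diamondop>\<^bsub>two_cat_of K\<^esub> surf_class K b = surf_class K (VComp a b)"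
proof (intro Set.set_eqI iffI)
  fix c assume "c \<in> surf_class K a \<diamondop>\<^bsub>two_cat_of K\<^esub> surf_class K b"
  then obtain a' b' where "seq K a a'" "seq K b b'" "seq K (VComp a' b') c"
    by (auto simp: two_cat_of_def surf_rel_def)
  then show "c \<in> surf_class K (VComp a b)"
    using assms seq_trans[OF seq_vcong, of K a a' b b' c] by simp
next
  fix c assume "c \<in> surf_class K (VComp a b)"
  then show "c \<in> surf_class K a \<diamondop>\<^bsub>two_cat_of K\<^esub> surf_class K b"
    using seq_refl[OF assms(1)] seq_refl[OF assms(2)]
    by (simp add: two_cat_of_def surf_rel_def Image_iff Bex_def) blast
qed

lemma hcomp_class [simp]:
  assumes "swf K a" "swf K b" "ptgt K (ssrc K a) = psrc K (ssrc K b)"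
  shows "surf_class K a \<star>\<^bsub>two_cat_of K\<^esub> surf_class K b = surf_class K (HComp a b)"
proof (intro Set.set_eqI iffI)
  fix c assume "c \<in> surf_class K a \<star>\<^bsub>two_cat_of K\<^esub> surf_class K b"
  then obtain a' b' where "seq K a a'" "seq K b b'" "seq K (HComp a' b') c"
    by (auto simp: two_cat_of_def surf_rel_def)
  then show "c \<in> surf_class K (HComp a b)"
    using assms seq_trans[OF seq_hcong, of K a a' b b' c] by simp
next
  fix c assume "c \<in> surf_class K (HComp a b)"
  then show "c \<in> surf_class K a \<star>\<^bsub>two_cat_of K\<^esub> surf_class K b"
    using seq_refl[OF assms(1)] seq_refl[OF assms(2)]
    by (simp add: two_cat_of_def surf_rel_def Image_iff Bex_def) blast
qed

lemma swf_bd_simps: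
  assumes "swf K a"
  shows "pwf K (ssrc K a)" "pwf K (stgt K a)" "psrc K (stgt K a) = psrc K (ssrc K a)"
    "ptgt K (stgt K a) = ptgt K (ssrc K a)"
  using swf_bd[OF assms] by simp_all

theorem strict_2_category_two_cat_of: "strict_2_category (two_cat_of K)"
proof unfold_locales
  fix f1 f1' f2 f2'
  assume *: "f1 \<in> Cell (two_cat_of K)" "f1' \<in> Cell (two_cat_of K)"
    "f2 \<in> Cell (two_cat_of K)" "f2' \<in> Cell (two_cat_of K)"
    "tgt2 (two_cat_of K) f1 = src2 (two_cat_of K) f1'"
    "tgt2 (two_cat_of K) f2 = src2 (two_cat_of K) f2'"
    "tgt1 (two_cat_of K) (src2 (two_cat_of K) f1) = src1 (two_cat_of K) (src2 (two_cat_of K) f2)"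
  obtain a a' b b' where f: "f1 = surf_class K a" "f1' = surf_class K a'"
      "f2 = surf_class K b" "f2' = surf_class K b'"
    and wf: "swf K a" "swf K a'" "swf K b" "swf K b'"
    using *(1-4) by (auto simp: Cell_two_cat_of)
  have p: "peq K (stgt K a) (ssrc K a')" "peq K (stgt K b) (ssrc K b')"
    "ptgt K (ssrc K a) = psrc K (ssrc K b)"
    using *(5-7) wf by (simp_all add: f swf_bd_simps path_class_eq_iff)
  have q: "ptgt K (ssrc K a') = psrc K (ssrc K b')"
    using peq_wf[OF p(1)] peq_wf[OF p(2)] p(3) wf by (simp add: swf_bd_simps)
  have "peq K (stgt K (HComp a b)) (ssrc K (HComp a' b'))"
    using wf p by (auto simp: swf_bd_simps intro!: peq_cong)
  then show "(f1 \<diamondop>\<^bsub>two_cat_of K\<^esub> f1') \<star>\<^bsub>two_cat_of K\<^esub> (f2 \<diamondop>\<^bsub>two_cat_of K\<^esub> f2') =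
      (f1 \<star>\<^bsub>two_cat_of K\<^esub> f2) \<diamondop>\<^bsub>two_cat_of K\<^esub> (f1' \<star>\<^bsub>two_cat_of K\<^esub> f2')"
    using wf p q by (simp add: f surf_class_eq[OF seq_exchange])
next
  fix f1 f2 f3
  assume *: "f1 \<in> Cell (two_cat_of K)" "f2 \<in> Cell (two_cat_of K)" "f3 \<in> Cell (two_cat_of K)"
  then obtain a b c where f: "f1 = surf_class K a" "f2 = surf_class K b" "f3 = surf_class K c"
    and wf: "swf K a" "swf K b" "swf K c"
    by (auto simp: Cell_two_cat_of)
  {
    assume "tgt2 (two_cat_of K) f1 = src2 (two_cat_of K) f2"
      "tgt2 (two_cat_of K) f2 = src2 (two_cat_of K) f3"
    then have "peq K (stgt K a) (ssrc K b)" "peq K (stgt K b) (ssrc K c)"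
      using wf by (simp_all add: f swf_bd_simps path_class_eq_iff)
    then show "f1 \<diamondop>\<^bsub>two_cat_of K\<^esub> f2 \<diamondop>\<^bsub>two_cat_of K\<^esub> f3 =
        f1 \<diamondop>\<^bsub>two_cat_of K\<^esub> (f2 \<diamondop>\<^bsub>two_cat_of K\<^esub> f3)"
      using wf by (simp add: f surf_class_eq[OF seq_vassoc])
  next
    assume "tgt1 (two_cat_of K) (src2 (two_cat_of K) f1) = src1 (two_cat_of K) (src2 (two_cat_of K) f2)"
      "tgt1 (two_cat_of K) (src2 (two_cat_of K) f2) = src1 (two_cat_of K) (src2 (two_cat_of K) f3)"
    then have "ptgt K (ssrc K a) = psrc K (ssrc K b)" "ptgt K (ssrc K b) = psrc K (ssrc K c)"
      using wf by (simp_all add: f swf_bd_simps)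
    then show "f1 \<star>\<^bsub>two_cat_of K\<^esub> f2 \<star>\<^bsub>two_cat_of K\<^esub> f3 =
        f1 \<star>\<^bsub>two_cat_of K\<^esub> (f2 \<star>\<^bsub>two_cat_of K\<^esub> f3)"
      using wf by (simp add: f surf_class_eq[OF seq_hassoc])
  }
next
  fix f assume "f \<in> Cell (two_cat_of K)"
  then obtain a where f: "f = surf_class K a" and wf: "swf K a"
    by (auto simp: Cell_two_cat_of)
  note [simp] = swf_bd_simps[OF wf] peq_refl psrc_in ptgt_in wf f
  show "src2 (two_cat_of K) f \<in> Mor (two_cat_of K)" "tgt2 (two_cat_of K) f \<in> Mor (two_cat_of K)"
    by (auto simp: Mor_two_cat_of)
  show "id2 (two_cat_of K) (src2 (two_cat_of K) f) \<diamondop>\<^bsub>two_cat_of K\<^esub> f = f"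
    by (simp add: surf_class_eq[OF seq_vunit_left])
  show "f \<diamondop>\<^bsub>two_cat_of K\<^esub> id2 (two_cat_of K) (tgt2 (two_cat_of K) f) = f"
    by (simp add: surf_class_eq[OF seq_vunit_right])
  show "src1 (two_cat_of K) (src2 (two_cat_of K) f) = src1 (two_cat_of K) (tgt2 (two_cat_of K) f)"
    "tgt1 (two_cat_of K) (src2 (two_cat_of K) f) = tgt1 (two_cat_of K) (tgt2 (two_cat_of K) f)"
    by simp_all
  show "id2 (two_cat_of K) (id1 (two_cat_of K) (src1 (two_cat_of K) (src2 (two_cat_of K) f)))
      \<star>\<^bsub>two_cat_of K\<^esub> f = f"
    by (simp add: surf_class_eq[OF seq_hunit_left])
  show "f \<star>\<^bsub>two_cat_of K\<^esub>
      id2 (two_cat_of K) (id1 (two_cat_of K) (tgt1 (two_cat_of K) (src2 (two_cat_of K) f))) = f"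
    by (simp add: surf_class_eq[OF seq_hunit_right])
next
  fix f f' assume "f \<in> Cell (two_cat_of K)" "f' \<in> Cell (two_cat_of K)"
  then obtain a b where f: "f = surf_class K a" "f' = surf_class K b" and wf: "swf K a" "swf K b"
    by (auto simp: Cell_two_cat_of)
  note simps = swf_bd_simps[OF wf(1)] swf_bd_simps[OF wf(2)] wf f
  {
    assume "tgt2 (two_cat_of K) f = src2 (two_cat_of K) f'"
    then have p: "peq K (stgt K a) (ssrc K b)"
      by (simp add: simps path_class_eq_iff)
    then show "f \<diamondop>\<^bsub>two_cat_of K\<^esub> f' \<in> Cell (two_cat_of K)"
      by (simp add: simps) (simp add: Cell_two_cat_of simps)
    from p show "src2 (two_cat_of K) (f \<diamondop>\<^bsub>two_cat_of K\<^esub> f') = src2 (two_cat_of K) f"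
      "tgt2 (two_cat_of K) (f \<diamondop>\<^bsub>two_cat_of K\<^esub> f') = tgt2 (two_cat_of K) f'"
      by (simp_all add: simps)
  next
    assume "tgt1 (two_cat_of K) (src2 (two_cat_of K) f) = src1 (two_cat_of K) (src2 (two_cat_of K) f')"
    then have p: "ptgt K (ssrc K a) = psrc K (ssrc K b)"
      by (simp add: simps)
    then show "f \<star>\<^bsub>two_cat_of K\<^esub> f' \<in> Cell (two_cat_of K)"
      by (simp add: simps) (simp add: Cell_two_cat_of simps)
    from p show "src2 (two_cat_of K) (f \<star>\<^bsub>two_cat_of K\<^esub> f') =
        src2 (two_cat_of K) f \<cdot>\<^bsub>two_cat_of K\<^esub> src2 (two_cat_of K) f'"
      "tgt2 (two_cat_of K) (f \<star>\<^bsub>two_cat_of K\<^esub> f') =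
        tgt2 (two_cat_of K) f \<cdot>\<^bsub>two_cat_of K\<^esub> tgt2 (two_cat_of K) f'"
      by (simp_all add: simps)
  }
qed (auto simp: Mor_two_cat_of Cell_two_cat_of psrc_in ptgt_in path_class_eq[OF peq_assoc]
    path_class_eq[OF peq_unit_left] path_class_eq[OF peq_unit_right] surf_class_eq[OF seq_id_comp])

end

section \<open>Tetrahedra, 2-holonomy, 2-actions\<close>

text \<open>The vertices, edges and faces are indexed by numbers in \<open>{1..4}\<close>; other indices are irrelevant.\<close>

definition tetrahedron ::
    "('v, 'e, 'f) complex2 \<Rightarrow> (nat \<Rightarrow> 'v) \<Rightarrow> (nat \<Rightarrow> nat \<Rightarrow> 'e) \<Rightarrow> (nat \<Rightarrow> nat \<Rightarrow> nat \<Rightarrow> 'f) \<Rightarrow> bool" where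
  "tetrahedron K v e \<phi> \<longleftrightarrow>
     (\<forall>i\<in>{1..4}. v i \<in> verts K) \<and>
     (\<forall>i\<in>{1..4}. \<forall>j\<in>{1..4}. i < j \<longrightarrow>
        e i j \<in> edges K \<and> esrc K (e i j) = v i \<and> etgt K (e i j) = v j) \<and>
     (\<forall>i\<in>{1..4}. \<forall>j\<in>{1..4}. \<forall>k\<in>{1..4}. i < j \<and> j < k \<longrightarrow>
        \<phi> i j k \<in> faces K \<and> bd1 K (\<phi> i j k) = e i j \<and> bd2 K (\<phi> i j k) = e j k \<and>
        rev_edge K (bd3 K (\<phi> i j k)) = e i k)"

definition two_holonomy ::
    "('v, 'e, 'f) complex2 \<Rightarrow> ('g, 'm) monoid_scheme \<Rightarrow> ('h, 'n) monoid_scheme \<Rightarrow>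
      ('h \<Rightarrow> 'g) \<Rightarrow> ('g \<Rightarrow> 'h \<Rightarrow> 'h) \<Rightarrow>
      (('v, 'e) path set \<Rightarrow> 'g) \<Rightarrow> (('v, 'e, 'f) surf set \<Rightarrow> 'h \<times> 'g) \<Rightarrow>
      (nat \<Rightarrow> nat \<Rightarrow> 'e) \<Rightarrow> (nat \<Rightarrow> nat \<Rightarrow> nat \<Rightarrow> 'f) \<Rightarrow> 'h \<times> 'g" where
  "two_holonomy K G H t \<alpha> F1 F2 e \<phi> =
     (let D = two_groupoid G H t \<alpha>;
          g = (\<lambda>i j. F1 (path_class K (Edge (e i j))));
          f = (\<lambda>i j k. F2 (surf_class K (Face (\<phi> i j k))))
      in vinv G H t (f 1 2 4) \<diamondop>\<^bsub>D\<^esub> (id2 D (g 1 2) \<star>\<^bsub>D\<^esub> vinv G H t (f 2 3 4)) \<diamondop>\<^bsub>D\<^esub>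
         (f 1 2 3 \<star>\<^bsub>D\<^esub> id2 D (g 3 4)) \<diamondop>\<^bsub>D\<^esub> f 1 3 4)"

text \<open>A 2-action is only constrained on pairs whose first component lies in the kernel of \<open>t\<close>.\<close>

definition two_action ::
    "('g, 'm) monoid_scheme \<Rightarrow> ('h, 'n) monoid_scheme \<Rightarrow> ('h \<Rightarrow> 'g) \<Rightarrow> ('g \<Rightarrow> 'h \<Rightarrow> 'h) \<Rightarrow>
      ('h \<times> 'g \<Rightarrow> real) \<Rightarrow> bool" where
  "two_action G H t \<alpha> S \<longleftrightarrow>
     (\<exists>s0. (\<forall>h\<in>kernel H G t. \<forall>g\<in>carrier G. S (h, g) = s0 h) \<and>
           (\<forall>h\<in>kernel H G t. \<forall>h'\<in>carrier H. s0 (h' \<otimes>\<^bsub>H\<^esub> h \<otimes>\<^bsub>H\<^esub> inv\<^bsub>H\<^esub> h') = s0 h) \<and>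
           (\<forall>h\<in>kernel H G t. \<forall>g\<in>carrier G. s0 (\<alpha> g h) = s0 h))"

end

theory Submission
  imports Defs
begin

text \<open>
  Write \<open>h\<^sub>i\<^sub>j\<^sub>k\<close> and \<open>k\<^sub>i\<^sub>j\<close> for the \<open>H\<close>-components of \<open>\<F>(\<phi>\<^sub>i\<^sub>j\<^sub>k)\<close> and \<open>\<eta>\<close> at \<open>e\<^sub>i\<^sub>j\<close>. Naturality at a face reads
  \<open>k\<^sub>i\<^sub>k h\<^sub>i\<^sub>j\<^sub>k = \<alpha>(\<eta>\<^sub>i)[h'\<^sub>i\<^sub>j\<^sub>k] k\<^sub>i\<^sub>j \<alpha>(g\<^sub>i\<^sub>j)[k\<^sub>j\<^sub>k]\<close>, and the 2-holonomy is the unique solution \<open>h\<close> of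
  \<open>h h\<^sub>1\<^sub>2\<^sub>4 \<alpha>(g\<^sub>1\<^sub>2)[h\<^sub>2\<^sub>3\<^sub>4] = h\<^sub>1\<^sub>3\<^sub>4 h\<^sub>1\<^sub>2\<^sub>3\<close>. Pasting the four naturality equations with the Peiffer identity
  gives \<open>k\<^sub>1\<^sub>4 h = \<alpha>(\<eta>\<^sub>1)[h'] k\<^sub>1\<^sub>4\<close>: the two 2-holonomies differ by the action of \<open>\<eta>\<^sub>1\<close> and a
  conjugation, and a 2-action is insensitive to both.
\<close>

section \<open>Tetrahedra in a crossed module: pure algebra with elements of \<open>G\<close> and
  \<open>H\<close>\<close>

context lie_crossed_module
begin

text \<open>The \<open>H\<close>-component of the pasted 2-holonomy. Vertical composition multiplies
  \<open>H\<close>-components in reverse, so the last cell \<open>h134\<close> comes first;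
  whiskering by \<open>g12\<close> on the left produces \<open>\<alpha> g12\<close>, whiskering on
  the right leaves \<open>h123\<close> unchanged.\<close>

definition tetra_hol :: "'g \<Rightarrow> 'h \<Rightarrow> 'h \<Rightarrow> 'h \<Rightarrow> 'h \<Rightarrow> 'h" where
  "tetra_hol g12 h123 h124 h134 h234 =
     h134 \<otimes>\<^bsub>H\<^esub> (h123 \<otimes>\<^bsub>H\<^esub> (\<alpha> g12 (inv\<^bsub>H\<^esub> h234) \<otimes>\<^bsub>H\<^esub> inv\<^bsub>H\<^esub> h124))"

lemma tetra_hol_closed [simp]:
  assumes "g12 \<in> carrier G" "h123 \<in> carrier H" "h124 \<in> carrier H" "h134 \<in> carrier H"
    "h234 \<in> carrier H"
  shows "tetra_hol g12 h123 h124 h134 h234 \<in> carrier H"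
  using assms by (simp add: tetra_hol_def)

text \<open>The inverse-free form of the definition. Later arguments use only this equation and
  cancellation.\<close>

lemma tetra_hol_mult:
  assumes [simp]: "g12 \<in> carrier G" "h123 \<in> carrier H" "h124 \<in> carrier H" "h134 \<in> carrier H"
    "h234 \<in> carrier H"
  shows "tetra_hol g12 h123 h124 h134 h234 \<otimes>\<^bsub>H\<^esub> (h124 \<otimes>\<^bsub>H\<^esub> \<alpha> g12 h234) = h134 \<otimes>\<^bsub>H\<^esub> h123"
proof -
  have "\<alpha> g12 (inv\<^bsub>H\<^esub> h234) \<otimes>\<^bsub>H\<^esub> \<alpha> g12 h234 = \<one>\<^bsub>H\<^esub>"
    by (simp flip: \<alpha>_mult)
  then show ?thesis
    by (simp add: tetra_hol_def H.m_assoc H.inv_solve_left' flip: H.m_assoc[of "inv\<^bsub>H\<^esub> h124"])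
qed

text \<open>Both sides of \<open>tetra_hol_mult\<close> label 2-morphisms from
  \<open>g12 g23 g34\<close> to \<open>g14\<close>, so the discrepancy between them has trivial
  image under \<open>t\<close>.\<close>

lemma tetra_hol_in_kernel:
  assumes g [simp]: "g12 \<in> carrier G" "g23 \<in> carrier G" "g34 \<in> carrier G"
    and h [simp]: "h123 \<in> carrier H" "h124 \<in> carrier H" "h134 \<in> carrier H" "h234 \<in> carrier H"
    and t123: "t h123 \<otimes>\<^bsub>G\<^esub> (g12 \<otimes>\<^bsub>G\<^esub> g23) = g13"
    and t124: "t h124 \<otimes>\<^bsub>G\<^esub> (g12 \<otimes>\<^bsub>G\<^esub> g24) = g14"
    and t134: "t h134 \<otimes>\<^bsub>G\<^esub> (g13 \<otimes>\<^bsub>G\<^esub> g34) = g14"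
    and t234: "t h234 \<otimes>\<^bsub>G\<^esub> (g23 \<otimes>\<^bsub>G\<^esub> g34) = g24"
  shows "tetra_hol g12 h123 h124 h134 h234 \<in> kernel H G t"
proof -
  let ?h = "tetra_hol g12 h123 h124 h134 h234"
  have c [simp]: "g24 \<in> carrier G" "g14 \<in> carrier G"
    by (auto simp flip: t234 t124)
  have "g14 = t (h134 \<otimes>\<^bsub>H\<^esub> h123) \<otimes>\<^bsub>G\<^esub> (g12 \<otimes>\<^bsub>G\<^esub> (g23 \<otimes>\<^bsub>G\<^esub> g34))"
    by (simp add: G.m_assoc flip: t134 t123)
  also have "\<dots> = t (?h \<otimes>\<^bsub>H\<^esub> (h124 \<otimes>\<^bsub>H\<^esub> \<alpha> g12 h234)) \<otimes>\<^bsub>G\<^esub> (g12 \<otimes>\<^bsub>G\<^esub> (g23 \<otimes>\<^bsub>G\<^esub> g34))"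
    by (simp only: tetra_hol_mult g h)
  \<comment> \<open>Equivariance (\<open>t_\<alpha>_mult\<close>) moves the image of
    \<open>h234\<close> past \<open>g12\<close>, where \<open>t234\<close> and then
    \<open>t124\<close> absorb it.\<close>
  also have "\<dots> = t ?h \<otimes>\<^bsub>G\<^esub> g14"
    by (simp add: G.m_assoc t_\<alpha>_mult flip: t124 t234)
  finally show ?thesis
    by (simp add: kernel_def)
qed

text \<open>Both sides are compared after multiplication on the right by
  \<open>h124 \<alpha>(g12)[h234]\<close>. The naturality equations are used in the order 134, 123,
  234, 124: the first two trade unprimed faces for primed ones, the last two restore the factor to
  be cancelled.\<close>

lemma tetra_hol_natural:
  assumes [simp]: "g12 \<in> carrier G" "g23 \<in> carrier G" "g12' \<in> carrier G"
      "a1 \<in> carrier G" "a2 \<in> carrier G"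
    and h [simp]: "h123 \<in> carrier H" "h124 \<in> carrier H" "h134 \<in> carrier H" "h234 \<in> carrier H"
    and h' [simp]: "h123' \<in> carrier H" "h124' \<in> carrier H" "h134' \<in> carrier H" "h234' \<in> carrier H"
    and k [simp]: "k12 \<in> carrier H" "k13 \<in> carrier H" "k14 \<in> carrier H" "k23 \<in> carrier H"
      "k24 \<in> carrier H" "k34 \<in> carrier H"
    and t12: "t k12 \<otimes>\<^bsub>G\<^esub> (g12 \<otimes>\<^bsub>G\<^esub> a2) = a1 \<otimes>\<^bsub>G\<^esub> g12'"
    and t123: "t h123 \<otimes>\<^bsub>G\<^esub> (g12 \<otimes>\<^bsub>G\<^esub> g23) = g13"
    and n123: "k13 \<otimes>\<^bsub>H\<^esub> h123 = \<alpha> a1 h123' \<otimes>\<^bsub>H\<^esub> (k12 \<otimes>\<^bsub>H\<^esub> \<alpha> g12 k23)"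
    and n124: "k14 \<otimes>\<^bsub>H\<^esub> h124 = \<alpha> a1 h124' \<otimes>\<^bsub>H\<^esub> (k12 \<otimes>\<^bsub>H\<^esub> \<alpha> g12 k24)"
    and n134: "k14 \<otimes>\<^bsub>H\<^esub> h134 = \<alpha> a1 h134' \<otimes>\<^bsub>H\<^esub> (k13 \<otimes>\<^bsub>H\<^esub> \<alpha> g13 k34)"
    and n234: "k24 \<otimes>\<^bsub>H\<^esub> h234 = \<alpha> a2 h234' \<otimes>\<^bsub>H\<^esub> (k23 \<otimes>\<^bsub>H\<^esub> \<alpha> g23 k34)"
  shows "tetra_hol g12 h123 h124 h134 h234 =
    inv\<^bsub>H\<^esub> k14 \<otimes>\<^bsub>H\<^esub> \<alpha> a1 (tetra_hol g12' h123' h124' h134' h234') \<otimes>\<^bsub>H\<^esub> k14"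
proof -
  let ?x = "tetra_hol g12 h123 h124 h134 h234"
  let ?x' = "tetra_hol g12' h123' h124' h134' h234'"
  let ?r = "\<alpha> g12 (k23 \<otimes>\<^bsub>H\<^esub> \<alpha> g23 k34)"
  have [simp]: "g13 \<in> carrier G"
    by (auto simp flip: t123)
  \<comment> \<open>By \<open>t123\<close>, the actions of \<open>g13\<close> and
    \<open>g12 g23\<close> differ by conjugation with \<open>h123\<close>; this is the exchange law
    for face 123 and edge 34.\<close>
  have p: "\<alpha> g13 k34 \<otimes>\<^bsub>H\<^esub> h123 = h123 \<otimes>\<^bsub>H\<^esub> \<alpha> (g12 \<otimes>\<^bsub>G\<^esub> g23) k34"
    by (simp add: \<alpha>_comp peiffer_mult flip: t123)
  \<comment> \<open>Likewise for edge 12 and face 234, with \<open>t12\<close> as the relation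
    between the two actions.\<close>
  have q: "\<alpha> a1 (\<alpha> g12' h234') \<otimes>\<^bsub>H\<^esub> k12 = k12 \<otimes>\<^bsub>H\<^esub> \<alpha> g12 (\<alpha> a2 h234')"
  proof -
    have "\<alpha> a1 (\<alpha> g12' h234') = \<alpha> (t k12) (\<alpha> g12 (\<alpha> a2 h234'))"
      using arg_cong[OF t12, of "\<lambda>g. \<alpha> g h234'"] by (simp add: \<alpha>_comp)
    then show ?thesis
      by (simp add: peiffer_mult)
  qed
  have "(k14 \<otimes>\<^bsub>H\<^esub> ?x) \<otimes>\<^bsub>H\<^esub> (h124 \<otimes>\<^bsub>H\<^esub> \<alpha> g12 h234) = (k14 \<otimes>\<^bsub>H\<^esub> h134) \<otimes>\<^bsub>H\<^esub> h123"
    by (simp add: H.m_assoc tetra_hol_mult)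
  also have "\<dots> = \<alpha> a1 h134' \<otimes>\<^bsub>H\<^esub> (k13 \<otimes>\<^bsub>H\<^esub> (\<alpha> g13 k34 \<otimes>\<^bsub>H\<^esub> h123))"
    by (simp add: n134 H.m_assoc)
  also have "\<dots> = \<alpha> a1 h134' \<otimes>\<^bsub>H\<^esub> ((k13 \<otimes>\<^bsub>H\<^esub> h123) \<otimes>\<^bsub>H\<^esub> \<alpha> (g12 \<otimes>\<^bsub>G\<^esub> g23) k34)"
    by (simp add: p H.m_assoc)
  also have "\<dots> = \<alpha> a1 (h134' \<otimes>\<^bsub>H\<^esub> h123') \<otimes>\<^bsub>H\<^esub> (k12 \<otimes>\<^bsub>H\<^esub> ?r)"
    by (simp add: n123 H.m_assoc \<alpha>_mult \<alpha>_comp)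
  also have "h134' \<otimes>\<^bsub>H\<^esub> h123' = ?x' \<otimes>\<^bsub>H\<^esub> (h124' \<otimes>\<^bsub>H\<^esub> \<alpha> g12' h234')"
    by (simp add: tetra_hol_mult)
  also have "\<alpha> a1 \<dots> \<otimes>\<^bsub>H\<^esub> (k12 \<otimes>\<^bsub>H\<^esub> ?r) =
      \<alpha> a1 ?x' \<otimes>\<^bsub>H\<^esub> (\<alpha> a1 h124' \<otimes>\<^bsub>H\<^esub> ((\<alpha> a1 (\<alpha> g12' h234') \<otimes>\<^bsub>H\<^esub> k12) \<otimes>\<^bsub>H\<^esub> ?r))"
    by (simp add: \<alpha>_mult H.m_assoc)
  also have "\<dots> = \<alpha> a1 ?x' \<otimes>\<^bsub>H\<^esub> (\<alpha> a1 h124' \<otimes>\<^bsub>H\<^esub> (k12 \<otimes>\<^bsub>H\<^esub> \<alpha> g12 (k24 \<otimes>\<^bsub>H\<^esub> h234)))"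
    by (simp add: q n234 \<alpha>_mult H.m_assoc)
  also have "\<dots> = \<alpha> a1 ?x' \<otimes>\<^bsub>H\<^esub> ((k14 \<otimes>\<^bsub>H\<^esub> h124) \<otimes>\<^bsub>H\<^esub> \<alpha> g12 h234)"
    by (simp add: n124 \<alpha>_mult H.m_assoc)
  also have "\<dots> = (\<alpha> a1 ?x' \<otimes>\<^bsub>H\<^esub> k14) \<otimes>\<^bsub>H\<^esub> (h124 \<otimes>\<^bsub>H\<^esub> \<alpha> g12 h234)"
    by (simp add: H.m_assoc)
  finally have "k14 \<otimes>\<^bsub>H\<^esub> ?x = \<alpha> a1 ?x' \<otimes>\<^bsub>H\<^esub> k14"
    by simp
  then show ?thesis
    by (simp add: H.m_assoc H.inv_solve_left)
qed

text \<open>The base points \<open>g\<close> and \<open>g'\<close> may differ because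
  \<open>S\<close> sees only the \<open>H\<close>-component. Since \<open>s0\<close> is constrained
  only on the kernel, \<open>\<alpha> a x'\<close> and \<open>x\<close> must first be placed
  there.\<close>

lemma two_action_conj:
  assumes "two_action G H t \<alpha> S"
    and x': "x' \<in> kernel H G t" and x: "x = inv\<^bsub>H\<^esub> k \<otimes>\<^bsub>H\<^esub> \<alpha> a x' \<otimes>\<^bsub>H\<^esub> k"
    and [simp]: "k \<in> carrier H" "a \<in> carrier G" "g \<in> carrier G" "g' \<in> carrier G"
  shows "S (x, g) = S (x', g')"
proof -
  obtain s0 where S: "\<And>h g. h \<in> kernel H G t \<Longrightarrow> g \<in> carrier G \<Longrightarrow> S (h, g) = s0 h"
    and conj: "\<And>h h'. h \<in> kernel H G t \<Longrightarrow> h' \<in> carrier H \<Longrightarrow> s0 (h' \<otimes>\<^bsub>H\<^esub> h \<otimes>\<^bsub>H\<^esub> inv\<^bsub>H\<^esub> h') = s0 h"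
    and act: "\<And>h g. h \<in> kernel H G t \<Longrightarrow> g \<in> carrier G \<Longrightarrow> s0 (\<alpha> g h) = s0 h"
    using assms(1) unfolding two_action_def by blast
  have [simp]: "x' \<in> carrier H" "t x' = \<one>\<^bsub>G\<^esub>"
    using x' by (auto simp: kernel_def)
  have y: "\<alpha> a x' \<in> kernel H G t"
    by (simp add: kernel_def t_equivariant)
  then have "t (inv\<^bsub>H\<^esub> k) \<otimes>\<^bsub>G\<^esub> t k = \<one>\<^bsub>G\<^esub>"
    by (simp flip: t_mult)
  with y have "x \<in> kernel H G t"
    by (simp add: kernel_def x)
  \<comment> \<open>Conjugating by \<open>inv k\<close> puts the inverse on the left, as in
    \<open>x\<close>.\<close>
  moreover have "s0 x = s0 (\<alpha> a x')"
    using conj[OF y, of "inv\<^bsub>H\<^esub> k"] by (simp add: x)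
  ultimately show ?thesis
    using x' by (simp add: S act)
qed

end

section \<open>Strict 2-functors into the 2-groupoid, in components\<close>

lemma tetrahedron_edge:
  assumes "tetrahedron K v e \<phi>" "1 \<le> i" "i < j" "j \<le> 4"
  shows "e i j \<in> edges K" "esrc K (e i j) = v i" "etgt K (e i j) = v j"
  using assms by (simp_all add: tetrahedron_def)

lemma tetrahedron_face:
  assumes "tetrahedron K v e \<phi>" "1 \<le> i" "i < j" "j < k" "k \<le> 4"
  shows "\<phi> i j k \<in> faces K" "bd1 K (\<phi> i j k) = e i j" "bd2 K (\<phi> i j k) = e j k"
    "rev_edge K (bd3 K (\<phi> i j k)) = e i k"
  using assms by (simp_all add: tetrahedron_def)

locale crossed_module_functor =
  simplicial_2_complex K + lie_crossed_module G H t \<alpha> +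
  strict_2_functor "two_cat_of K" "two_groupoid G H t \<alpha>" F0 F1 F2
  for K :: "('v, 'e, 'f) complex2"
    and G :: "'g lie_group_struct" and H :: "'h lie_group_struct"
    and t \<alpha> F0 F1 F2
begin

definition edge_hol :: "'e \<Rightarrow> 'g" where
  "edge_hol e = F1 (path_class K (Edge e))"

text \<open>The \<open>G\<close>-component is not recorded: preservation of sources determines it
  from the edges.\<close>

definition face_hol :: "'f \<Rightarrow> 'h" where
  "face_hol f = fst (F2 (surf_class K (Face f)))"

lemma F1_closed: "pwf K p \<Longrightarrow> F1 (path_class K p) \<in> carrier G"
  using F1_in[of "path_class K p"] by (auto simp: Mor_two_cat_of two_groupoid_def)

lemma edge_hol_closed [simp]: "e \<in> edges K \<Longrightarrow> edge_hol e \<in> carrier G"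
  using F1_closed[of "Edge e"] by (simp add: edge_hol_def)

lemma F1_Comp:
  assumes "pwf K p" "pwf K q" "ptgt K p = psrc K q"
  shows "F1 (path_class K (Comp p q)) = F1 (path_class K p) \<otimes>\<^bsub>G\<^esub> F1 (path_class K q)"
  using F_comp1[of "path_class K p" "path_class K q"] assms
  by (auto simp: Mor_two_cat_of two_groupoid_def)

text \<open>Preservation of sources gives the \<open>G\<close>-component; preservation of targets
  gives the last equation, the fake-flatness condition of lattice gauge theory.\<close>

lemma
  assumes f: "f \<in> faces K"
  shows face_hol_closed [simp]: "face_hol f \<in> carrier H"
    and F2_Face: "F2 (surf_class K (Face f)) =
      (face_hol f, edge_hol (bd1 K f) \<otimes>\<^bsub>G\<^esub> edge_hol (bd2 K f))"
    and t_face_hol: "t (face_hol f) \<otimes>\<^bsub>G\<^esub> (edge_hol (bd1 K f) \<otimes>\<^bsub>G\<^esub> edge_hol (bd2 K f)) =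
      edge_hol (rev_edge K (bd3 K f))"
proof -
  let ?c = "surf_class K (Face f)"
  have c: "?c \<in> Cell (two_cat_of K)"
    using f by (auto simp: Cell_two_cat_of)
  have "F1 (path_class K (Comp (Edge (bd1 K f)) (Edge (bd2 K f)))) =
      edge_hol (bd1 K f) \<otimes>\<^bsub>G\<^esub> edge_hol (bd2 K f)"
    using f by (simp add: F1_Comp edge_hol_def bd1_in bd2_in bd_21)
  with F2_in[OF c] F_src2[OF c] F_tgt2[OF c] f
  show "face_hol f \<in> carrier H"
    "F2 ?c = (face_hol f, edge_hol (bd1 K f) \<otimes>\<^bsub>G\<^esub> edge_hol (bd2 K f))"
    "t (face_hol f) \<otimes>\<^bsub>G\<^esub> (edge_hol (bd1 K f) \<otimes>\<^bsub>G\<^esub> edge_hol (bd2 K f)) =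
      edge_hol (rev_edge K (bd3 K f))"
    by (auto simp: face_hol_def edge_hol_def two_groupoid_def semidirect_product_def split: prod.splits)
qed

lemma two_holonomy_eq:
  assumes "tetrahedron K v e \<phi>"
  shows "two_holonomy K G H t \<alpha> F1 F2 e \<phi> =
    (tetra_hol (edge_hol (e 1 2)) (face_hol (\<phi> 1 2 3)) (face_hol (\<phi> 1 2 4)) (face_hol (\<phi> 1 3 4))
       (face_hol (\<phi> 2 3 4)), edge_hol (e 1 4))"
proof -
  note T = tetrahedron_edge[OF assms] tetrahedron_face[OF assms]
  \<comment> \<open>A vertical composite keeps the source of its first cell, here the inverse of
    face 124, so its base point is the target of that face.\<close>
  have t124: "t (face_hol (\<phi> 1 2 4)) \<otimes>\<^bsub>G\<^esub> (edge_hol (e 1 2) \<otimes>\<^bsub>G\<^esub> edge_hol (e 2 4)) = edge_hol (e 1 4)"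
    using t_face_hol[of "\<phi> 1 2 4"] by (simp add: T)
  then show ?thesis
    by (simp add: two_holonomy_def Let_def F2_Face T vinv_def two_groupoid_def semidirect_product_def
        tetra_hol_def flip: edge_hol_def)
qed

lemma tetra_hol_holonomy_in_kernel:
  assumes "tetrahedron K v e \<phi>"
  shows "tetra_hol (edge_hol (e 1 2)) (face_hol (\<phi> 1 2 3)) (face_hol (\<phi> 1 2 4)) (face_hol (\<phi> 1 3 4))
       (face_hol (\<phi> 2 3 4)) \<in> kernel H G t"
proof -
  note T = tetrahedron_edge[OF assms] tetrahedron_face[OF assms]
  have t: "t (face_hol (\<phi> i j k)) \<otimes>\<^bsub>G\<^esub> (edge_hol (e i j) \<otimes>\<^bsub>G\<^esub> edge_hol (e j k)) = edge_hol (e i k)"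
    if "1 \<le> i" "i < j" "j < k" "k \<le> 4" for i j k
    using t_face_hol[of "\<phi> i j k"] that by (simp add: T)
  show ?thesis
    by (rule tetra_hol_in_kernel[OF _ _ _ _ _ _ _ t t t t]) (simp_all add: T)
qed

end

section \<open>Pseudo-natural transformations in components, and invariance\<close>

locale crossed_module_transformation =
  F: crossed_module_functor K G H t \<alpha> F0 F1 F2 +
  F': crossed_module_functor K G H t \<alpha> F0' F1' F2' +
  pseudonatural_transformation "two_cat_of K" "two_groupoid G H t \<alpha>" F0 F1 F2 F0' F1' F2' \<eta>0 \<eta>1
  for K :: "('v, 'e, 'f) complex2"
    and G :: "'g lie_group_struct" and H :: "'h lie_group_struct"
    and t \<alpha> F0 F1 F2 F0' F1' F2' \<eta>0 \<eta>1
begin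

definition edge_comp :: "'e \<Rightarrow> 'h" where
  "edge_comp e = fst (\<eta>1 (path_class K (Edge e)))"

lemma \<eta>0_closed [simp]: "v \<in> verts K \<Longrightarrow> \<eta>0 v \<in> carrier G"
  using \<eta>0_in[of v] by (simp add: two_groupoid_def)

lemma
  assumes e: "e \<in> edges K"
  shows edge_comp_closed [simp]: "edge_comp e \<in> carrier H"
    and \<eta>1_Edge: "\<eta>1 (path_class K (Edge e)) =
      (edge_comp e, F.edge_hol e \<otimes>\<^bsub>G\<^esub> \<eta>0 (etgt K e))"
    and t_edge_comp: "t (edge_comp e) \<otimes>\<^bsub>G\<^esub> (F.edge_hol e \<otimes>\<^bsub>G\<^esub> \<eta>0 (etgt K e)) =
      \<eta>0 (esrc K e) \<otimes>\<^bsub>G\<^esub> F'.edge_hol e"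
proof -
  let ?p = "path_class K (Edge e)"
  have p: "?p \<in> Mor (two_cat_of K)"
    using e by (auto simp: F.Mor_two_cat_of)
  have "\<eta>1 ?p \<in> Cell (two_groupoid G H t \<alpha>)"
    using \<eta>1_iso[OF p] by (simp add: two_iso_def)
  with \<eta>1_src[OF p] \<eta>1_tgt[OF p] e
  show "edge_comp e \<in> carrier H"
    "\<eta>1 ?p = (edge_comp e, F.edge_hol e \<otimes>\<^bsub>G\<^esub> \<eta>0 (etgt K e))"
    "t (edge_comp e) \<otimes>\<^bsub>G\<^esub> (F.edge_hol e \<otimes>\<^bsub>G\<^esub> \<eta>0 (etgt K e)) = \<eta>0 (esrc K e) \<otimes>\<^bsub>G\<^esub> F'.edge_hol e"
    by (auto simp: edge_comp_def F.edge_hol_def F'.edge_hol_def two_groupoid_def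
        semidirect_product_def split: prod.splits)
qed

text \<open>Only the cell at \<open>e'\<close> is whiskered on the left, hence the single
  \<open>\<alpha>\<close>; the reversed order of vertical composition puts
  \<open>edge_comp e\<close> in front.\<close>

lemma \<eta>1_Comp:
  assumes "e \<in> edges K" "e' \<in> edges K" "etgt K e = esrc K e'"
  shows "fst (\<eta>1 (path_class K (Comp (Edge e) (Edge e')))) =
    edge_comp e \<otimes>\<^bsub>H\<^esub> \<alpha> (F.edge_hol e) (edge_comp e')"
proof -
  have "path_class K (Edge e) \<in> Mor (two_cat_of K)" "path_class K (Edge e') \<in> Mor (two_cat_of K)"
    using assms by (auto simp: F.Mor_two_cat_of)
  then show ?thesis
    using \<eta>_comp[of "path_class K (Edge e)" "path_class K (Edge e')"] assms
    by (simp add: \<eta>1_Edge two_groupoid_def semidirect_product_def F.esrc_in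
        flip: F.edge_hol_def F'.edge_hol_def)
qed

text \<open>The \<open>H\<close>-component of \<open>\<eta>_cell\<close> at a generating face. Its
  target is the reversed third boundary edge, which in a tetrahedron is
  \<open>e i k\<close>.\<close>

lemma face_natural:
  assumes f: "f \<in> faces K"
  shows "edge_comp (rev_edge K (bd3 K f)) \<otimes>\<^bsub>H\<^esub> F.face_hol f =
    \<alpha> (\<eta>0 (esrc K (bd1 K f))) (F'.face_hol f) \<otimes>\<^bsub>H\<^esub>
    (edge_comp (bd1 K f) \<otimes>\<^bsub>H\<^esub> \<alpha> (F.edge_hol (bd1 K f)) (edge_comp (bd2 K f)))"
proof -
  let ?c = "surf_class K (Face f)"
  note wf = f F.bd1_in F.bd2_in F.bd3_in F.rev_in F.bd_21 F.esrc_in F.etgt_in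
  have "?c \<in> Cell (two_cat_of K)"
    using f by (auto simp: F.Cell_two_cat_of)
  from \<eta>_cell[OF this]
  have "fst (\<eta>1 (path_class K (Edge (rev_edge K (bd3 K f))))) \<otimes>\<^bsub>H\<^esub> F.face_hol f =
    \<alpha> (\<eta>0 (esrc K (bd1 K f))) (F'.face_hol f) \<otimes>\<^bsub>H\<^esub>
    fst (\<eta>1 (path_class K (Comp (Edge (bd1 K f)) (Edge (bd2 K f)))))"
    by (auto simp: wf F.F2_Face F'.F2_Face two_groupoid_def semidirect_product_def
        split: prod.splits)
  then show ?thesis
    by (simp add: wf \<eta>1_Comp flip: edge_comp_def)
qed

theorem two_action_two_holonomy:
  assumes S: "two_action G H t \<alpha> S" and T0: "tetrahedron K v e \<phi>"
  shows "S (two_holonomy K G H t \<alpha> F1 F2 e \<phi>) = S (two_holonomy K G H t \<alpha> F1' F2' e \<phi>)"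
proof -
  note T = tetrahedron_edge[OF T0] tetrahedron_face[OF T0]
  have v: "v i \<in> verts K" if "1 \<le> i" "i \<le> 4" for i
    using T0 that by (simp add: tetrahedron_def)
  have n: "edge_comp (e i k) \<otimes>\<^bsub>H\<^esub> F.face_hol (\<phi> i j k) =
      \<alpha> (\<eta>0 (v i)) (F'.face_hol (\<phi> i j k)) \<otimes>\<^bsub>H\<^esub>
      (edge_comp (e i j) \<otimes>\<^bsub>H\<^esub> \<alpha> (F.edge_hol (e i j)) (edge_comp (e j k)))"
    if "1 \<le> i" "i < j" "j < k" "k \<le> 4" for i j k
    using face_natural[of "\<phi> i j k"] that by (simp add: T)
  have t12: "t (edge_comp (e 1 2)) \<otimes>\<^bsub>G\<^esub> (F.edge_hol (e 1 2) \<otimes>\<^bsub>G\<^esub> \<eta>0 (v 2)) =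
      \<eta>0 (v 1) \<otimes>\<^bsub>G\<^esub> F'.edge_hol (e 1 2)"
    using t_edge_comp[of "e 1 2"] by (simp add: T)
  have t123: "t (F.face_hol (\<phi> 1 2 3)) \<otimes>\<^bsub>G\<^esub> (F.edge_hol (e 1 2) \<otimes>\<^bsub>G\<^esub> F.edge_hol (e 2 3)) =
      F.edge_hol (e 1 3)"
    using F.t_face_hol[of "\<phi> 1 2 3"] by (simp add: T)
  \<comment> \<open>\<open>F.tetra_hol\<close> serves both functors, since it depends only on the
    shared crossed module.\<close>
  have "F.tetra_hol (F.edge_hol (e 1 2)) (F.face_hol (\<phi> 1 2 3)) (F.face_hol (\<phi> 1 2 4))
      (F.face_hol (\<phi> 1 3 4)) (F.face_hol (\<phi> 2 3 4)) =
    inv\<^bsub>H\<^esub> edge_comp (e 1 4) \<otimes>\<^bsub>H\<^esub> \<alpha> (\<eta>0 (v 1)) (F.tetra_hol (F'.edge_hol (e 1 2)) (F'.face_hol (\<phi> 1 2 3))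
      (F'.face_hol (\<phi> 1 2 4)) (F'.face_hol (\<phi> 1 3 4)) (F'.face_hol (\<phi> 2 3 4))) \<otimes>\<^bsub>H\<^esub> edge_comp (e 1 4)"
    \<comment> \<open>The blanks are carrier conditions; the copies of \<open>n\<close> belong to
      faces 123, 124, 134 and 234.\<close>
    by (rule F.tetra_hol_natural[OF _ _ _ _ _ _ _ _ _ _ _ _ _ _ _ _ _ _ _ t12 t123 n n n n])
       (simp_all add: T v)
  then show ?thesis
    unfolding F.two_holonomy_eq[OF T0] F'.two_holonomy_eq[OF T0]
    by (rule F.two_action_conj[OF S F'.tetra_hol_holonomy_in_kernel[OF T0]])
       (simp_all add: T v)
qed

end

theorem theorem4p8:
  fixes K :: "('v, 'e, 'f) complex2"
    and G :: "'g lie_group_struct" and H :: "'h lie_group_struct"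
    and t :: "'h \<Rightarrow> 'g" and \<alpha> :: "'g \<Rightarrow> 'h \<Rightarrow> 'h"
    and F0 F0' :: "'v \<Rightarrow> unit"
    and F1 F1' :: "('v, 'e) path set \<Rightarrow> 'g"
    and F2 F2' :: "('v, 'e, 'f) surf set \<Rightarrow> 'h \<times> 'g"
    and S :: "'h \<times> 'g \<Rightarrow> real"
  assumes "simplicial_2_complex K"
    and "lie_crossed_module G H t \<alpha>"
    and "strict_2_functor (two_cat_of K) (two_groupoid G H t \<alpha>) F0 F1 F2"
    and "strict_2_functor (two_cat_of K) (two_groupoid G H t \<alpha>) F0' F1' F2'"
    and "two_action G H t \<alpha> S"
    and "\<exists>\<eta>0 \<eta>1. pseudonatural_transformation (two_cat_of K) (two_groupoid G H t \<alpha>)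
           F0 F1 F2 F0' F1' F2' \<eta>0 \<eta>1"
  shows "\<forall>v e \<phi>. tetrahedron K v e \<phi> \<longrightarrow>
    S (two_holonomy K G H t \<alpha> F1 F2 e \<phi>) = S (two_holonomy K G H t \<alpha> F1' F2' e \<phi>)"
proof (intro allI impI)
  fix v e \<phi> assume T: "tetrahedron K v e \<phi>"
  obtain \<eta>0 \<eta>1 where "pseudonatural_transformation (two_cat_of K) (two_groupoid G H t \<alpha>)
      F0 F1 F2 F0' F1' F2' \<eta>0 \<eta>1"
    using assms(6) by blast
  then interpret crossed_module_transformation K G H t \<alpha> F0 F1 F2 F0' F1' F2' \<eta>0 \<eta>1
    by (intro crossed_module_transformation.intro crossed_module_functor.intro assms(1-4))
  show "S (two_holonomy K G H t \<alpha> F1 F2 e \<phi>) = S (two_holonomy K G H t \<alpha> F1' F2' e \<phi>)"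
    by (rule two_action_two_holonomy[OF assms(5) T])
qed

end
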